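(* Let $c\geqslant 3$ and let $\mathcal P$ be a $c$-oriented polyhedron with $f$ faces. Then $\mathcal P$ can be guarded by at most $$\left\lfloor \frac f2-\frac fc\right\rfloor$$ face guards; this holds both for closed face guards and for open face guards. (No assumption is made on the genus of $\mathcal P$ or on the number of its cavities.)
   Context: A polyhedron is a connected subset of $\mathbb R^3$ that is a union of finitely many closed tetrahedra and whose boundary is a (possibly non-connected) orientable 2-manifold. A face is a maximal planar subset of the boundary with connected, non-empty relative interior (a plane polygon, possibly with holes). A point $x$ is visible to a point $y$ if no point of the segment $xy$ lies in the exterior of the polyhedron; $\mathcal V(x)$ is the set of points visible to $x$, and $\mathcal V(S)=\bigcup_{x\in S}\mathcal V(x)$. A set $S$ guards the polyhedron if $\mathcal V(S)$ is the whole polyhedron (including its boundary). A closed face guard is a face including its relative boundary; an open face guard is the relative interior of a face. A set of face guards guards $\mathcal P$ if the union of the guards guards $\mathcal P$. A polyhedron is $c$-oriented if there exist $c$ unit vectors such that every face is orthogonal to one of them. *)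

theory Defs
  imports "HOL-Analysis.Analysis"
begin

type_synonym point = "real^3"

definition tetrahedron :: "point set \<Rightarrow> bool" where
  "tetrahedron T \<longleftrightarrow> (\<exists>V. card V = 4 \<and> \<not> affine_dependent V \<and> T = convex hull V)"

definition two_manifold :: "point set \<Rightarrow> bool" where
  "two_manifold S \<longleftrightarrow>
     (\<forall>x\<in>S. \<exists>U. openin (top_of_set S) U \<and> x \<in> U \<and> U homeomorphic ball (0::real^2) 1)"

definition polyhedron :: "point set \<Rightarrow> bool" where
  "polyhedron P \<longleftrightarrow>
     connected P \<and>
     (\<exists>\<T>. finite \<T> \<and> \<T> \<noteq> {} \<and> (\<forall>T\<in>\<T>. tetrahedron T) \<and> P = \<Union>\<T>) \<and>
     two_manifold (frontier P)"

text \<open>A planar region of the boundary: a plane polygon (possibly with holes),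
  i.e. a planar set that is the closure of its non-empty, connected relative interior.\<close>
definition planar_region :: "point set \<Rightarrow> point set \<Rightarrow> bool" where
  "planar_region P F \<longleftrightarrow>
     F \<subseteq> frontier P \<and> aff_dim F = 2 \<and>
     rel_interior F \<noteq> {} \<and> connected (rel_interior F) \<and> F = closure (rel_interior F)"

definition face :: "point set \<Rightarrow> point set \<Rightarrow> bool" where
  "face P F \<longleftrightarrow> planar_region P F \<and> (\<forall>G. planar_region P G \<and> F \<subseteq> G \<longrightarrow> G = F)"

definition faces :: "point set \<Rightarrow> point set set" where
  "faces P = {F. face P F}"

definition visible :: "point set \<Rightarrow> point \<Rightarrow> point \<Rightarrow> bool" where
  "visible P x y \<longleftrightarrow> closed_segment x y \<subseteq> P"

definition vis_region :: "point set \<Rightarrow> point set \<Rightarrow> point set" where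
  "vis_region P S = (\<Union>x\<in>S. {y. visible P x y})"

definition guards :: "point set \<Rightarrow> point set \<Rightarrow> bool" where
  "guards P S \<longleftrightarrow> vis_region P S = P"

definition c_oriented :: "nat \<Rightarrow> point set \<Rightarrow> bool" where
  "c_oriented c P \<longleftrightarrow>
     (\<exists>U. card U = c \<and> (\<forall>u\<in>U. norm u = 1) \<and>
          (\<forall>F\<in>faces P. \<exists>u\<in>U. \<forall>x\<in>F. \<forall>y\<in>F. (x - y) \<bullet> u = 0))"

end

(*
  Among the c normal directions, two are shared by at least 2f/c of the faces. Let d be a direction
  orthogonal to both of them. Then at most f - 2f/c faces are transversal to d; each of them is
  crossed outwards by exactly one of the directions d and -d, so for one of the two signs the faces
  that are left outwards number at most f/2 - f/c. These faces guard the polyhedron: from any point x,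
  moving in direction d, slightly tilted towards a generic interior point near x, one never hits a
  face parallel to d, and one leaves the polyhedron through the relative interior of a face that d
  crosses outwards.
*)
theory Submission
  imports Defs
begin

text \<open>Two normals are used because any two vectors of space have a common nonzero orthogonal
  vector, while three need not. The obstacle is that guards may be open faces: a ray along
  \<open>d\<close> may run inside a face or end on an edge, where it meets no relative interior. The
  tilt has to be generic enough to meet one plane at a time, yet so small that it neither reverses
  the sense in which a plane is crossed nor reaches a plane parallel to \<open>d\<close> before the
  ray is out of \<open>P\<close>; compactness of \<open>P\<close> bounds that length. Faces are
  given only by maximality, so their existence at flat boundary points, their finite number and the
  constancy of the outer side along each of them have to be derived. The planes of the tetrahedra
  provide a finite arrangement that contains the boundary, and faces are compared with its
  cells.\<close>

section \<open>General position with respect to finitely many hyperplanes\<close>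

lemma two_sided_perturbation:
  fixes a y :: "'a::real_inner"
  assumes "open S" "y \<in> S"
  obtains t where "t > 0" "y + t *\<^sub>R a \<in> S" "y - t *\<^sub>R a \<in> S"
proof -
  obtain e where e: "e > 0" "ball y e \<subseteq> S"
    using assms openE by blast
  define t where "t = e / (2 * (norm a + 1))"
  have t: "t > 0"
    using e by (auto simp: t_def intro!: divide_pos_pos add_nonneg_pos)
  have "t * norm a < e"
  proof -
    have "t * norm a \<le> t * (norm a + 1)"
      using t by simp
    also have "\<dots> = e / 2"
      using norm_ge_zero[of a] by (simp add: t_def field_simps add_nonneg_eq_0_iff)
    finally show ?thesis using e by simp
  qed
  then have "y + t *\<^sub>R a \<in> ball y e" "y - t *\<^sub>R a \<in> ball y e"
    using t by (auto simp: dist_norm)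
  with e t that show ?thesis by blast
qed

text \<open>Planes are removed one at a time. Moving a point by \<open>t\<close> along
  \<open>a\<close> and along \<open>- a\<close> gives values of the linear form that differ by
  \<open>2 * t * (a \<bullet> a)\<close>, so at most one of the two new points lies in the plane.
  Later choices of generic points rest on this.\<close>

lemma open_avoids_hyperplanes:
  fixes S :: "'a::real_inner set"
  assumes "finite M" "\<And>a b. (a, b) \<in> M \<Longrightarrow> a \<noteq> 0" "open S" "S \<noteq> {}"
  shows "\<exists>y\<in>S. \<forall>(a, b)\<in>M. a \<bullet> y \<noteq> b"
  using assms
proof (induction arbitrary: S)
  case empty
  then show ?case by auto
next
  case (insert m M)
  obtain a b where m: "m = (a, b)" by fastforce
  with insert have a: "a \<noteq> 0" by auto
  have "open (S \<inter> {y. a \<bullet> y \<noteq> b})"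
    using insert.prems by (intro open_Int open_Collect_neq) (auto intro!: continuous_intros)
  moreover have "S \<inter> {y. a \<bullet> y \<noteq> b} \<noteq> {}"
  proof -
    obtain y where y: "y \<in> S" using insert.prems by auto
    obtain t where t: "t > 0" "y + t *\<^sub>R a \<in> S" "y - t *\<^sub>R a \<in> S"
      using two_sided_perturbation insert.prems(2) y by blast
    have "t * (a \<bullet> a) > 0" using t a by simp
    then have "a \<bullet> (y + t *\<^sub>R a) \<noteq> b \<or> a \<bullet> (y - t *\<^sub>R a) \<noteq> b"
      by (auto simp: inner_simps)
    with t show ?thesis by auto
  qed
  ultimately obtain y where "y \<in> S \<inter> {y. a \<bullet> y \<noteq> b}" "\<forall>(a, b)\<in>M. a \<bullet> y \<noteq> b"
    using insert.IH[of "S \<inter> {y. a \<bullet> y \<noteq> b}"] insert.prems(1) by auto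
  then show ?case using m by auto
qed

text \<open>The planes missing \<open>q\<close> have a closed union. If the planes of
  \<open>M\<close> cover the boundary, then inside this ball only those through \<open>q\<close>
  carry boundary points, which makes the solid conical near \<open>q\<close>.\<close>

lemma ball_avoids_hyperplanes:
  fixes q :: "'a::real_inner"
  assumes "finite M"
  obtains e where "e > 0" "\<forall>a b y. (a, b) \<in> M \<longrightarrow> a \<bullet> q \<noteq> b \<longrightarrow> y \<in> ball q e \<longrightarrow> a \<bullet> y \<noteq> b"
proof -
  define C where "C = (\<Union>(a, b)\<in>{m\<in>M. fst m \<bullet> q \<noteq> snd m}. {y. a \<bullet> y = b})"
  have "closed C"
    unfolding C_def using assms by (intro closed_UN) (auto simp: closed_hyperplane)
  moreover have "q \<notin> C" by (auto simp: C_def)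
  ultimately obtain e where "e > 0" "ball q e \<subseteq> - C"
    by (metis ComplI open_Compl openE)
  then show ?thesis
    by (intro that[of e]) (force simp: C_def)+
qed

lemma open_same_side:
  fixes a :: "'a::real_inner"
  assumes "a \<bullet> x \<noteq> b"
  shows "open {y. sgn (a \<bullet> y - b) = sgn (a \<bullet> x - b)}"
proof (cases "a \<bullet> x > b")
  case True
  then have "{y. sgn (a \<bullet> y - b) = sgn (a \<bullet> x - b)} = {y. a \<bullet> y > b}"
    by (auto simp: sgn_if split: if_splits)
  then show ?thesis by (simp add: open_halfspace_gt)
next
  case False
  with assms have "{y. sgn (a \<bullet> y - b) = sgn (a \<bullet> x - b)} = {y. a \<bullet> y < b}"
    by (auto simp: sgn_if split: if_splits)
  then show ?thesis by (simp add: open_halfspace_lt)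
qed

lemma short_step_in_ball:
  fixes z v y :: "'a::real_normed_vector"
  assumes "z \<in> ball y e"
  obtains \<delta> where "\<delta> > 0" "\<And>t. 0 < t \<Longrightarrow> t < \<delta> \<Longrightarrow> z + t *\<^sub>R v \<in> ball y e"
proof -
  have "((\<lambda>t. z + t *\<^sub>R v) \<longlongrightarrow> z + 0 *\<^sub>R v) (at_right 0)"
    by (intro tendsto_intros)
  then have "eventually (\<lambda>t. z + t *\<^sub>R v \<in> ball y e) (at_right 0)"
    using assms by (intro topological_tendstoD) auto
  then show ?thesis using that by (auto simp: eventually_at_right_field)
qed

lemma connected_misses_frontier:
  assumes "connected C" "C \<inter> frontier S = {}" "C \<inter> S \<noteq> {}"
  shows "C \<subseteq> interior S"
proof -
  have "C \<subseteq> S" using connected_Int_frontier[of C S] assms by blast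
  with assms(2) closure_subset show ?thesis by (fastforce simp: frontier_def)
qed

text \<open>Meant for a vanishing combination of two normals: this is how two planes met at the same
  moment are recognised as one.\<close>

lemma proportional_hyperplanes:
  fixes a a' :: "'a::real_inner"
  assumes "k *\<^sub>R a' = k' *\<^sub>R a" "k \<noteq> 0" "k' \<noteq> 0" "a \<bullet> q = b" "a' \<bullet> q = b'"
  shows "{x. a' \<bullet> x = b'} = {x. a \<bullet> x = b}"
proof -
  have "k * (a' \<bullet> x - b') = k' * (a \<bullet> x - b)" for x
  proof -
    have "(k *\<^sub>R a') \<bullet> (x - q) = (k' *\<^sub>R a) \<bullet> (x - q)" using assms(1) by simp
    then show ?thesis using assms(4,5) by (simp add: inner_diff_right right_diff_distrib)
  qed
  then have "a' \<bullet> x = b' \<longleftrightarrow> a \<bullet> x = b" for x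
    using assms(2,3) by (metis eq_iff_diff_eq_0 mult_eq_0_iff)
  then show ?thesis by blast
qed

lemma eventually_tilted_inner_nonzero:
  fixes w d v :: "'a::real_inner"
  assumes "w \<bullet> v \<noteq> 0"
  shows "\<forall>\<^sub>F \<epsilon> in at_right 0. w \<bullet> (d + \<epsilon> *\<^sub>R v) \<noteq> 0"
proof (cases "w \<bullet> d = 0")
  case True
  then show ?thesis
    using assms by (auto simp: eventually_at_right_field inner_simps intro!: exI[of _ 1])
next
  case False
  have "((\<lambda>\<epsilon>. w \<bullet> (d + \<epsilon> *\<^sub>R v)) \<longlongrightarrow> w \<bullet> (d + 0 *\<^sub>R v)) (at_right 0)"
    by (intro tendsto_intros)
  then show ?thesis
    using False by (intro tendsto_imp_eventually_ne) auto
qed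

text \<open>A positive product expresses that the tilted direction crosses a plane with normal
  \<open>w\<close> in the same sense as \<open>d\<close>.\<close>

lemma eventually_tilted_inner_sign:
  fixes w d v :: "'a::real_inner"
  assumes "w \<bullet> d \<noteq> 0"
  shows "\<forall>\<^sub>F \<epsilon> in at_right 0. (w \<bullet> (d + \<epsilon> *\<^sub>R v)) * (w \<bullet> d) > 0"
proof -
  have lim: "((\<lambda>\<epsilon>. (w \<bullet> (d + \<epsilon> *\<^sub>R v)) * (w \<bullet> d)) \<longlongrightarrow> (w \<bullet> (d + 0 *\<^sub>R v)) * (w \<bullet> d)) (at_right 0)"
    by (intro tendsto_intros)
  have "(w \<bullet> (d + 0 *\<^sub>R v)) * (w \<bullet> d) > 0"
    using assms by (simp add: zero_less_mult_iff linorder_neq_iff disj_commute)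
  with lim show ?thesis by (rule order_tendstoD(1))
qed

lemma eventually_scaled_less:
  fixes c k :: real
  assumes "c > 0"
  shows "\<forall>\<^sub>F \<epsilon> in at_right 0. \<epsilon> * k < c"
proof -
  have "((\<lambda>\<epsilon>. \<epsilon> * k) \<longlongrightarrow> 0 * k) (at_right 0)"
    by (intro tendsto_intros)
  then show ?thesis
    using assms by (intro order_tendstoD(2)) auto
qed

lemma generic_point_in_hyperplane:
  fixes W :: "(real^3) set"
  assumes "finite M" "a \<noteq> 0" "openin (top_of_set {x. a \<bullet> x = b}) W" "W \<noteq> {}"
  shows "\<exists>x\<in>W. \<forall>(a', b')\<in>M. a' \<noteq> 0 \<longrightarrow> a' \<bullet> x = b' \<longrightarrow> {y. a' \<bullet> y = b'} = {y. a \<bullet> y = b}"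
proof -
  \<comment> \<open>\<open>\<pi>\<close> is the orthogonal projection to the plane; it reduces the claim to the density of the
    complement of finitely many planes in space.\<close>
  define \<pi> where "\<pi> x = x - ((a \<bullet> x - b) / (a \<bullet> a)) *\<^sub>R a" for x
  define k where "k a' = (a' \<bullet> a) / (a \<bullet> a)" for a'
  have aa: "a \<bullet> a \<noteq> 0" using assms by simp
  have on: "a \<bullet> \<pi> x = b" for x
    using aa by (simp add: \<pi>_def inner_simps)
  have id: "\<pi> x = x" if "a \<bullet> x = b" for x
    using that by (simp add: \<pi>_def)
  obtain T where T: "open T" "W = {x. a \<bullet> x = b} \<inter> T"
    using assms(3) by (auto simp: openin_open)
  have "open (\<pi> -` T)"
    using T(1) assms(2) by (intro open_vimage) (auto simp: \<pi>_def intro!: continuous_intros)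
  moreover have "\<pi> -` T \<noteq> {}" using assms(4) T(2) id by fastforce
  \<comment> \<open>The pairs are the planes of \<open>M\<close> pulled back along \<pi>. The
    pulled-back normal vanishes exactly when \<open>a'\<close> is a multiple of \<open>a\<close>,
    which is the case of a plane parallel to the given one.\<close>
  ultimately have "\<exists>y\<in>\<pi> -` T. \<forall>(c, d)\<in>{(c, d)\<in>(\<lambda>(a', b'). (a' - k a' *\<^sub>R a, b' - b * k a')) ` M. c \<noteq> 0}.
      c \<bullet> y \<noteq> d"
    using finite_imageI[OF assms(1), of "\<lambda>(a', b'). (a' - k a' *\<^sub>R a, b' - b * k a')"]
    by (intro open_avoids_hyperplanes) (auto intro: finite_subset[rotated])
  then obtain y where y: "\<pi> y \<in> T" and
    off: "\<And>a' b'. (a', b') \<in> M \<Longrightarrow> a' - k a' *\<^sub>R a \<noteq> 0 \<Longrightarrow> (a' - k a' *\<^sub>R a) \<bullet> y \<noteq> b' - b * k a'"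
    by force
  have eq: "a' \<bullet> \<pi> y = (a' - k a' *\<^sub>R a) \<bullet> y + b * k a'" for a'
    using aa by (simp add: \<pi>_def k_def inner_simps field_simps)
  have "{y. a' \<bullet> y = b'} = {y. a \<bullet> y = b}" if "(a', b') \<in> M" "a' \<noteq> 0" "a' \<bullet> \<pi> y = b'" for a' b'
  proof -
    have "(a' - k a' *\<^sub>R a) \<bullet> y = b' - b * k a'" using eq[of a'] that(3) by simp
    then have *: "a' = k a' *\<^sub>R a" using off that(1) by fastforce
    then have "k a' \<noteq> 0" using that(2) by force
    moreover have "b' = k a' * b" using eq[of a'] that(3) * by simp
    ultimately show ?thesis
      by (subst *) simp
  qed
  moreover have "\<pi> y \<in> W" using y on T by simp
  ultimately show ?thesis by blast
qed

lemma coplanar_aff_dim: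
  fixes S :: "(real^3) set"
  assumes "aff_dim S = 2"
  obtains a b where "a \<noteq> 0" "affine hull S = {x. a \<bullet> x = b}"
proof -
  have "aff_dim S < DIM(real^3)" using assms by simp
  then obtain a b where ab: "a \<noteq> 0" "affine hull S \<subseteq> {x. a \<bullet> x = b}"
    by (metis aff_lowdim_subset_hyperplane aff_dim_affine_hull)
  have "affine hull S = {x. a \<bullet> x = b}"
    using ab assms by (intro affine_dim_equal) (auto simp: affine_hyperplane)
  with ab that show ?thesis by blast
qed

lemma openin_hyperplane_closure:
  fixes W :: "(real^3) set"
  assumes "a \<noteq> 0" "openin (top_of_set {x. a \<bullet> x = b}) W" "W \<noteq> {}"
  shows "affine hull W = {x. a \<bullet> x = b}" "affine hull (closure W) = {x. a \<bullet> x = b}"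
    "W \<subseteq> rel_interior (closure W)" "aff_dim (closure W) = 2"
proof -
  show hull: "affine hull W = {x. a \<bullet> x = b}"
    using affine_hull_openin[of "{x. a \<bullet> x = b}" W] assms affine_hyperplane[of a b] by (simp add: hull_same)
  show hull': "affine hull (closure W) = {x. a \<bullet> x = b}"
    using hull by simp
  show "W \<subseteq> rel_interior (closure W)"
    using assms(2) hull' by (intro rel_interior_maximal) (auto simp: closure_subset)
  have "aff_dim (closure W) = aff_dim {x. a \<bullet> x = b}"
    using hull' aff_dim_affine_hull by metis
  then show "aff_dim (closure W) = 2" using assms(1) by simp
qed

section \<open>The solid and its boundary near flat points\<close>

text \<open>A pair \<open>(a, b)\<close> in \<open>N\<close> stands for the plane \<open>a \<bullet> x = b\<close>. Different pairs may describe
  the same plane, and a plane of \<open>N\<close> may cut through the interior of a face.\<close>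

locale flat_sided_solid =
  fixes P :: "(real^3) set" and N :: "((real^3) \<times> real) set"
  assumes compact: "compact P"
    and regular: "closure (interior P) = P"
    and finite_planes: "finite N"
    and normal_nonzero: "(a, b) \<in> N \<Longrightarrow> a \<noteq> 0"
    and frontier_planes: "frontier P \<subseteq> (\<Union>(a, b)\<in>N. {x. a \<bullet> x = b})"
    and manifold: "two_manifold (frontier P)"
begin

lemma closed: "closed P"
  using compact compact_imp_closed by blast

lemma frontier_subset: "frontier P \<subseteq> P"
  using closed frontier_subset_closed by blast

lemma generic_interior_point:
  assumes "open S" "S \<inter> P \<noteq> {}" "finite M" "\<And>a b. (a, b) \<in> M \<Longrightarrow> a \<noteq> 0"
  shows "\<exists>y\<in>S \<inter> interior P. \<forall>(a, b)\<in>M. a \<bullet> y \<noteq> b"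
proof -
  have "S \<inter> interior P \<noteq> {}"
    using assms(1,2) regular open_Int_closure_eq_empty by metis
  then show ?thesis
    using assms by (intro open_avoids_hyperplanes) auto
qed

text \<open>The plane cuts the ball into two half balls that miss the boundary, so each is wholly
  inside or wholly outside. Not both are outside, since regularity yields interior points off the
  plane; not both are inside, since \<open>P\<close> is closed and \<open>q\<close> would be
  interior. The sign \<sigma> marks the outer side.\<close>

lemma one_sided:
  assumes q: "q \<in> frontier P" "a \<noteq> 0" "a \<bullet> q = b" and "e > 0"
    and fr: "frontier P \<inter> ball q e \<subseteq> {x. a \<bullet> x = b}"
  shows "\<exists>\<sigma>\<in>{1, -1}. \<forall>y\<in>ball q e. (\<sigma> * (a \<bullet> y - b) > 0 \<longrightarrow> y \<notin> P)
           \<and> (\<sigma> * (a \<bullet> y - b) < 0 \<longrightarrow> y \<in> interior P)"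
proof -
  define H where "H \<sigma> = ball q e \<inter> {y. \<sigma> * (a \<bullet> y - b) > 0}" for \<sigma> :: real
  have conn: "connected (H \<sigma>)" for \<sigma>
  proof -
    have "{y. \<sigma> * (a \<bullet> y - b) > 0} = {y. (\<sigma> *\<^sub>R a) \<bullet> y > \<sigma> * b}"
      by (auto simp: algebra_simps)
    then show ?thesis
      unfolding H_def by (metis convex_Int convex_ball convex_connected convex_halfspace_gt)
  qed
  have sides: "H \<sigma> \<subseteq> interior P \<or> H \<sigma> \<inter> P = {}" for \<sigma>
  proof -
    have "H \<sigma> \<inter> frontier P = {}" using fr by (auto simp: H_def)
    then show ?thesis using connected_misses_frontier[OF conn] by blast
  qed
  have off: "y \<in> H 1 \<or> y \<in> H (-1)" if "y \<in> ball q e" "a \<bullet> y \<noteq> b" for y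
    using that by (auto simp: H_def)
  have "\<not> (H 1 \<inter> P = {} \<and> H (-1) \<inter> P = {})"
  proof -
    have "ball q e \<inter> P \<noteq> {}" using q frontier_subset \<open>e > 0\<close> by (auto simp: disjoint_iff intro!: exI[of _ q])
    then obtain y where "y \<in> ball q e" "y \<in> interior P" "a \<bullet> y \<noteq> b"
      using generic_interior_point[of "ball q e" "{(a, b)}"] q by auto
    with off interior_subset show ?thesis by blast
  qed
  moreover have "\<not> (H 1 \<subseteq> interior P \<and> H (-1) \<subseteq> interior P)"
  proof
    assume *: "H 1 \<subseteq> interior P \<and> H (-1) \<subseteq> interior P"
    have "ball q e \<subseteq> P"
    proof (rule ccontr)
      assume "\<not> ball q e \<subseteq> P"
      then have "ball q e - P \<noteq> {}" "open (ball q e - P)" using closed by auto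
      then have "\<exists>y\<in>ball q e - P. \<forall>(a, b)\<in>{(a, b)}. a \<bullet> y \<noteq> b"
        using q by (intro open_avoids_hyperplanes) auto
      then obtain y where "y \<in> ball q e - P" "a \<bullet> y \<noteq> b" by blast
      with off * interior_subset show False by blast
    qed
    then have "q \<in> interior P" using \<open>e > 0\<close> by (meson centre_in_ball interiorI open_ball)
    with q show False by (simp add: frontier_def)
  qed
  ultimately have "H 1 \<subseteq> interior P \<and> H (-1) \<inter> P = {} \<or> H (-1) \<subseteq> interior P \<and> H 1 \<inter> P = {}"
    using sides by blast
  then show ?thesis
  proof
    assume "H 1 \<subseteq> interior P \<and> H (-1) \<inter> P = {}"
    then show ?thesis by (intro bexI[of _ "-1"]) (auto simp: H_def)
  next
    assume "H (-1) \<subseteq> interior P \<and> H 1 \<inter> P = {}"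
    then show ?thesis by (intro bexI[of _ 1]) (auto simp: H_def)
  qed
qed

text \<open>A short step off the disc along \<open>\<sigma> *\<^sub>R a\<close> leaves
  \<open>P\<close>, and the opposite step enters it, so the boundary near \<open>q\<close> fills the
  disc without gaps.\<close>

lemma local_plane_subset_frontier:
  assumes q: "q \<in> frontier P" "a \<noteq> 0" "a \<bullet> q = b" and "e > 0"
    and fr: "frontier P \<inter> ball q e \<subseteq> {x. a \<bullet> x = b}"
  shows "{x. a \<bullet> x = b} \<inter> ball q e \<subseteq> frontier P"
proof
  fix y assume y: "y \<in> {x. a \<bullet> x = b} \<inter> ball q e"
  obtain \<sigma> where \<sigma>: "\<sigma> \<in> {1, -1}" "\<And>y. y \<in> ball q e \<Longrightarrow> \<sigma> * (a \<bullet> y - b) > 0 \<Longrightarrow> y \<notin> P"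
      "\<And>y. y \<in> ball q e \<Longrightarrow> \<sigma> * (a \<bullet> y - b) < 0 \<Longrightarrow> y \<in> interior P"
    using one_sided[OF assms] by blast
  have "(\<exists>z\<in>T. z \<in> P) \<and> (\<exists>z\<in>T. z \<notin> P)" if "open T" "y \<in> T" for T
  proof -
    have "open (T \<inter> ball q e)" "y \<in> T \<inter> ball q e" using that y by auto
    then obtain t where t: "t > 0" "y + t *\<^sub>R (\<sigma> *\<^sub>R a) \<in> T \<inter> ball q e" "y - t *\<^sub>R (\<sigma> *\<^sub>R a) \<in> T \<inter> ball q e"
      by (rule two_sided_perturbation)
    have "\<sigma> * \<sigma> = 1" using \<sigma>(1) by auto
    then have "\<sigma> * (a \<bullet> (y + t *\<^sub>R (\<sigma> *\<^sub>R a)) - b) = t * (a \<bullet> a)"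
        "\<sigma> * (a \<bullet> (y - t *\<^sub>R (\<sigma> *\<^sub>R a)) - b) = - (t * (a \<bullet> a))"
      using y by (auto simp: inner_simps algebra_simps)
    moreover have "t * (a \<bullet> a) > 0" using t q by simp
    ultimately show ?thesis
      using \<sigma>(2)[of "y + t *\<^sub>R (\<sigma> *\<^sub>R a)"] \<sigma>(3)[of "y - t *\<^sub>R (\<sigma> *\<^sub>R a)"] t interior_subset by force
  qed
  then show "y \<in> frontier P"
    by (metis (no_types) closure_iff_nhds_not_empty disjoint_iff frontier_def DiffI interior_open open_interior interior_subset subset_iff closed closure_closed)
qed

section \<open>Faces as maximal flat pieces of the boundary\<close>

text \<open>Closing \<open>W\<close> can enlarge its relative interior, but the result lies between
  \<open>W\<close> and \<open>closure W\<close> and therefore stays connected.\<close>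

lemma planar_region_closure:
  assumes "a \<noteq> 0" "openin (top_of_set {x. a \<bullet> x = b}) W" "connected W" "W \<noteq> {}"
    and "W \<subseteq> frontier P"
  shows "planar_region P (closure W)"
proof -
  note cl = openin_hyperplane_closure[OF assms(1,2,4)]
  have "closure W \<subseteq> frontier P" using assms(5) by (simp add: closure_minimal)
  moreover have "connected (rel_interior (closure W))"
    using connected_intermediate_closure[OF assms(3) cl(3)] rel_interior_subset by blast
  moreover have "closure (rel_interior (closure W)) = closure W"
    using cl(3) by (metis closure_closure closure_mono rel_interior_subset subset_antisym)
  ultimately show ?thesis
    using cl assms(4) by (auto simp: planar_region_def)
qed

lemma face_plane:
  assumes "F \<in> faces P"
  obtains a b where "a \<noteq> 0" "affine hull F = {x. a \<bullet> x = b}"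
    "openin (top_of_set {x. a \<bullet> x = b}) (rel_interior F)"
proof -
  have "aff_dim F = 2" using assms by (simp add: faces_def face_def planar_region_def)
  then obtain a b where "a \<noteq> 0" "affine hull F = {x. a \<bullet> x = b}" by (rule coplanar_aff_dim)
  with that openin_rel_interior[of F] show ?thesis by simp
qed

lemma face_facts:
  assumes "F \<in> faces P"
  shows "F \<subseteq> frontier P" "rel_interior F \<noteq> {}" "connected (rel_interior F)"
    "closure (rel_interior F) = F"
  using assms unfolding faces_def face_def planar_region_def by blast+

text \<open>The closure of \<open>W \<union> rel_interior F\<close> is a planar region containing
  \<open>F\<close>, so maximality makes it equal to \<open>F\<close>.\<close>

lemma face_absorbs:
  assumes F: "F \<in> faces P"
    and W: "openin (top_of_set (affine hull F)) W" "connected W" "W \<subseteq> frontier P"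
    and meet: "W \<inter> rel_interior F \<noteq> {}"
  shows "W \<subseteq> rel_interior F"
proof -
  note ff = face_facts[OF F]
  obtain a b where ab: "a \<noteq> 0" "affine hull F = {x. a \<bullet> x = b}"
    "openin (top_of_set {x. a \<bullet> x = b}) (rel_interior F)"
    using face_plane[OF F] .
  define V where "V = W \<union> rel_interior F"
  have V: "openin (top_of_set {x. a \<bullet> x = b}) V" "connected V" "V \<noteq> {}" "V \<subseteq> frontier P"
    using W ab meet ff rel_interior_subset[of F]
    unfolding V_def by (auto intro!: openin_Un connected_Un)
  have "F \<subseteq> closure V" using ff(4) by (metis V_def closure_mono sup_ge2)
  then have "closure V = F"
    using F planar_region_closure[OF ab(1) V] by (auto simp: faces_def face_def)
  then show ?thesis
    using openin_hyperplane_closure(3)[OF ab(1) V(1,3)] by (auto simp: V_def)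
qed

text \<open>The face is the closure of the largest connected, relatively open piece of the boundary
  in this plane that contains \<open>q\<close>. A planar region containing it spans the same plane
  by dimension, and its relative interior is again a member of \<open>\<V>\<close>; this gives
  maximality.\<close>

lemma face_through_flat_point:
  assumes "a \<noteq> 0" "a \<bullet> q = b" "e > 0" and sub: "{x. a \<bullet> x = b} \<inter> ball q e \<subseteq> frontier P"
  shows "\<exists>F\<in>faces P. q \<in> rel_interior F"
proof -
  define H where "H = {x. a \<bullet> x = b}"
  define \<V> where "\<V> = {V. openin (top_of_set H) V \<and> connected V \<and> q \<in> V \<and> V \<subseteq> frontier P}"
  define W where "W = \<Union>\<V>"
  have "H \<inter> ball q e \<in> \<V>"
    using assms by (auto simp: \<V>_def H_def openin_open_Int intro!: convex_connected convex_Int convex_hyperplane)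
  then have q: "q \<in> W" by (auto simp: W_def \<V>_def)
  have op: "openin (top_of_set H) W" "W \<subseteq> frontier P"
    by (auto simp: W_def \<V>_def)
  have conn: "connected W"
    unfolding W_def by (rule connected_Union) (auto simp: \<V>_def)
  have ne: "W \<noteq> {}" using q by blast
  note pr = planar_region_closure[OF assms(1) op(1)[unfolded H_def] conn ne op(2)]
  note cl = openin_hyperplane_closure[OF assms(1) op(1)[unfolded H_def] ne, folded H_def]
  have "G = closure W" if G: "planar_region P G" "closure W \<subseteq> G" for G
  proof -
    have "aff_dim H = 2" using assms(1) by (simp add: H_def)
    moreover have "H \<subseteq> affine hull G" using G(2) cl(2) hull_mono by metis
    moreover have "aff_dim (affine hull G) = 2" using G by (simp add: planar_region_def)
    moreover have "affine H" by (simp add: H_def affine_hyperplane)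
    moreover have "H \<noteq> {}" using assms by (auto simp: H_def)
    ultimately have hull: "affine hull G = H" by (metis affine_affine_hull affine_dim_equal)
    then have "rel_interior (closure W) \<subseteq> rel_interior G"
      using G(2) cl(2) by (intro rel_interior_mono) auto
    then have "rel_interior G \<in> \<V>"
      using openin_rel_interior[of G] hull G(1) q cl(3) rel_interior_subset[of G]
      by (auto simp: \<V>_def planar_region_def)
    then have "rel_interior G \<subseteq> W" by (auto simp: W_def)
    then have "G \<subseteq> closure W"
      using G(1) closure_mono by (metis planar_region_def)
    with G show ?thesis by blast
  qed
  with pr have "closure W \<in> faces P" by (simp add: faces_def face_def)
  with q cl(3) show ?thesis by blast
qed

text \<open>This is the use of the manifold hypothesis: by invariance of domain, no other sheet of the
  boundary accumulates at a relative interior point of a face.\<close>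

lemma frontier_near_face:
  assumes F: "F \<in> faces P" and y: "y \<in> rel_interior F"
  shows "\<exists>e>0. frontier P \<inter> ball y e \<subseteq> rel_interior F"
proof -
  note ff = face_facts[OF F]
  have sub: "rel_interior F \<subseteq> frontier P" using ff rel_interior_subset by blast
  obtain U where U: "openin (top_of_set (frontier P)) U" "y \<in> U" "U homeomorphic ball (0::real^2) 1"
    using manifold y sub unfolding two_manifold_def by blast
  obtain h k where hk: "homeomorphism U (ball (0::real^2) 1) h k"
    using U(3) by (auto simp: homeomorphic_def)
  define D where "D = rel_interior F \<inter> U"
  obtain O1 where O1: "open O1" "U = frontier P \<inter> O1" using U(1) by (auto simp: openin_open)
  have D1: "D = rel_interior F \<inter> O1" using sub O1 by (auto simp: D_def)
  have "openin (top_of_set (affine hull F)) D"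
    using openin_rel_interior[of F] O1 unfolding D1 by (simp add: openin_Int_open)
  moreover have "continuous_on D h"
    using hk continuous_on_subset[of U h D] by (auto simp: homeomorphism_def D_def)
  moreover have "inj_on h D"
    using hk by (intro inj_on_inverseI[of _ k]) (auto simp: D_def homeomorphism_def)
  moreover have "aff_dim (UNIV::(real^2) set) \<le> aff_dim (affine hull F)"
    using F by (simp add: faces_def face_def planar_region_def)
  ultimately have "openin (top_of_set (UNIV::(real^2) set)) (h ` D)"
    by (intro invariance_of_domain_affine_sets[of "affine hull F"])
      (simp_all add: affine_affine_hull del: aff_dim_affine_hull aff_dim_UNIV)
  then have "open (h ` D)" by simp
  then have "openin (top_of_set (ball 0 1)) (h ` D)"
    using hk by (intro open_subset) (auto simp: D_def homeomorphism_def)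
  \<comment> \<open>Invariance of domain made the image of \<open>D\<close> open in the chart.
    Pulling it back shows \<open>D\<close> open in the boundary itself, not merely in the plane of
    \<open>F\<close>.\<close>
  then have "openin (top_of_set U) (U \<inter> h -` (h ` D))"
    using hk by (intro continuous_openin_preimage) (auto simp: homeomorphism_def)
  moreover have "U \<inter> h -` (h ` D) = D"
  proof -
    have "k (h u) = u" if "u \<in> U" for u using hk that by (simp add: homeomorphism_def)
    then have "z = w" if "z \<in> U" "w \<in> U" "h z = h w" for z w using that by metis
    then show ?thesis by (auto simp: D_def)
  qed
  ultimately have "openin (top_of_set (frontier P)) D"
    using U(1) openin_trans by metis
  then obtain O2 where O2: "open O2" "D = frontier P \<inter> O2" by (auto simp: openin_open)
  have "y \<in> D" using y U by (simp add: D_def)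
  then obtain e where "e > 0" "ball y e \<subseteq> O2" using O2 openE by blast
  with O2 show ?thesis by (intro exI[of _ e]) (auto simp: D_def)
qed

section \<open>Cells of the plane arrangement and finiteness of the set of faces\<close>

text \<open>The relatively open face through \<open>x\<close> of the arrangement given by
  \<open>N\<close>: the points with the same sign vector, where sign 0 keeps a point on the
  plane.\<close>

definition cell :: "real^3 \<Rightarrow> (real^3) set" where
  "cell x = {y. \<forall>(a, b)\<in>N. sgn (a \<bullet> y - b) = sgn (a \<bullet> x - b)}"

lemma cellD: "z \<in> cell x \<Longrightarrow> (a, b) \<in> N \<Longrightarrow> sgn (a \<bullet> z - b) = sgn (a \<bullet> x - b)"
  unfolding cell_def by blast

lemma convex_cell: "convex (cell x)"
proof -
  have "convex {y. sgn (a \<bullet> y - b) = sgn (a \<bullet> x - b)}" for a :: "real^3" and b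
  proof -
    consider "a \<bullet> x - b > 0" | "a \<bullet> x - b = 0" | "a \<bullet> x - b < 0" by linarith
    then show ?thesis
    proof cases
      case 1
      then have "{y. sgn (a \<bullet> y - b) = sgn (a \<bullet> x - b)} = {y. a \<bullet> y > b}"
        by (auto simp: sgn_if split: if_splits)
      then show ?thesis by (simp add: convex_halfspace_gt)
    next
      case 2
      then have "{y. sgn (a \<bullet> y - b) = sgn (a \<bullet> x - b)} = {y. a \<bullet> y = b}"
        by (auto simp: sgn_if split: if_splits)
      then show ?thesis by (simp add: convex_hyperplane)
    next
      case 3
      then have "{y. sgn (a \<bullet> y - b) = sgn (a \<bullet> x - b)} = {y. a \<bullet> y < b}"
        by (auto simp: sgn_if split: if_splits)
      then show ?thesis by (simp add: convex_halfspace_lt)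
    qed
  qed
  moreover have "cell x = (\<Inter>(a, b)\<in>N. {y. sgn (a \<bullet> y - b) = sgn (a \<bullet> x - b)})"
    by (auto simp: cell_def)
  ultimately show ?thesis by (auto intro!: convex_INT)
qed

text \<open>Faces are told apart by the sign vectors, relative to the planes of \<open>N\<close>, of generic points in
  them; hence there are finitely many faces.\<close>

lemma face_contains_cell:
  assumes F: "F \<in> faces P"
  shows "\<exists>x. x \<in> cell x \<and> cell x \<subseteq> rel_interior F \<and> openin (top_of_set (affine hull F)) (cell x)"
proof -
  note ff = face_facts[OF F]
  obtain a b where ab: "a \<noteq> 0" "affine hull F = {x. a \<bullet> x = b}"
    "openin (top_of_set {x. a \<bullet> x = b}) (rel_interior F)"
    using face_plane[OF F] .
  \<comment> \<open>The point is chosen so that every plane of \<open>N\<close> through it is the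
    plane of \<open>F\<close>.\<close>
  have "\<exists>x\<in>rel_interior F. \<forall>(a', b')\<in>N. a' \<noteq> 0 \<longrightarrow> a' \<bullet> x = b' \<longrightarrow> {y. a' \<bullet> y = b'} = {y. a \<bullet> y = b}"
    using ab ff finite_planes by (intro generic_point_in_hyperplane)
  then obtain x where x: "x \<in> rel_interior F"
    and gen: "\<And>a' b'. (a', b') \<in> N \<Longrightarrow> a' \<bullet> x = b' \<Longrightarrow> {y. a' \<bullet> y = b'} = {y. a \<bullet> y = b}"
    using normal_nonzero by fast
  have xfr: "x \<in> frontier P" using x ff(1) rel_interior_subset by blast
  then obtain a0 b0 where N0: "(a0, b0) \<in> N" "a0 \<bullet> x = b0" using frontier_planes by blast
  have on_plane: "a \<bullet> z = b" if "z \<in> cell x" for z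
  proof -
    have "sgn (a0 \<bullet> z - b0) = 0" using cellD[OF that N0(1)] N0(2) by simp
    then have "a0 \<bullet> z = b0" by (simp add: sgn_0_0)
    then show ?thesis using gen[OF N0] by blast
  qed
  \<comment> \<open>Zero signs at \<open>x\<close> only prescribe the plane of \<open>F\<close>, and
    nonzero signs are open conditions; so the cell is relatively open in that plane.\<close>
  have eq: "cell x = {x. a \<bullet> x = b} \<inter> (\<Inter>(a', b')\<in>{m\<in>N. fst m \<bullet> x \<noteq> snd m}.
      {y. sgn (a' \<bullet> y - b') = sgn (a' \<bullet> x - b')})" (is "_ = _ \<inter> ?T")
  proof (intro equalityI subsetI)
    fix z assume z: "z \<in> {x. a \<bullet> x = b} \<inter> ?T"
    have "sgn (a' \<bullet> z - b') = sgn (a' \<bullet> x - b')" if m: "(a', b') \<in> N" for a' b'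
    proof (cases "a' \<bullet> x = b'")
      case True
      then have "a' \<bullet> z = b'" using gen[OF m] z by blast
      with True show ?thesis by simp
    next
      case False
      with z m show ?thesis by auto
    qed
    then show "z \<in> cell x" by (auto simp: cell_def)
  next
    fix z assume z: "z \<in> cell x"
    with on_plane cellD[OF z] show "z \<in> {x. a \<bullet> x = b} \<inter> ?T" by auto
  qed
  have "open ?T" using finite_planes open_same_side by (intro open_INT) auto
  then have op: "openin (top_of_set {x. a \<bullet> x = b}) (cell x)"
    unfolding eq by (rule openin_open_Int)
  have xc: "x \<in> cell x" by (auto simp: cell_def)
  have conn: "connected (cell x)" using convex_cell convex_connected by blast
  \<comment> \<open>A clopen argument puts the whole cell on the boundary. Near a boundary point
    \<open>z\<close> of the cell, the boundary lies in planes of \<open>N\<close> through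
    \<open>z\<close>; these pass through \<open>x\<close> as well, hence all equal the plane of
    \<open>F\<close>, and \<open>local_plane_subset_frontier\<close> applies.\<close>
  have "openin (top_of_set (cell x)) (cell x \<inter> frontier P)"
  proof (subst openin_contains_ball, intro conjI ballI)
    fix z assume z: "z \<in> cell x \<inter> frontier P"
    obtain e where e: "e > 0" "\<forall>a b y. (a, b) \<in> N \<longrightarrow> a \<bullet> z \<noteq> b \<longrightarrow> y \<in> ball z e \<longrightarrow> a \<bullet> y \<noteq> b"
      using ball_avoids_hyperplanes[OF finite_planes, of z] .
    have gz: "{y. a' \<bullet> y = b'} = {y. a \<bullet> y = b}" if "(a', b') \<in> N" "a' \<bullet> z = b'" for a' b'
    proof (rule gen[OF that(1)])
      have "sgn (a' \<bullet> z - b') = sgn (a' \<bullet> x - b')" using z that cellD by blast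
      then show "a' \<bullet> x = b'" using that by (simp add: sgn_0_0)
    qed
    have "frontier P \<inter> ball z e \<subseteq> {x. a \<bullet> x = b}"
    proof
      fix y assume y: "y \<in> frontier P \<inter> ball z e"
      then obtain a' b' where m: "(a', b') \<in> N" "a' \<bullet> y = b'" using frontier_planes by blast
      with e(2) y have "a' \<bullet> z = b'" by blast
      with gz m show "y \<in> {x. a \<bullet> x = b}" by blast
    qed
    then have "{x. a \<bullet> x = b} \<inter> ball z e \<subseteq> frontier P"
      using z on_plane ab(1) e(1) by (intro local_plane_subset_frontier) auto
    then show "\<exists>e>0. ball z e \<inter> cell x \<subseteq> cell x \<inter> frontier P"
      using e(1) on_plane by blast
  qed auto
  moreover have "closedin (top_of_set (cell x)) (cell x \<inter> frontier P)"
    by (simp add: closedin_closed_Int)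
  ultimately have "cell x \<inter> frontier P = cell x"
    using conn xc xfr by (metis IntI connected_clopen empty_iff)
  then have "cell x \<subseteq> rel_interior F"
    using face_absorbs[OF F, of "cell x"] op ab(2) conn xc x by auto
  with xc op ab(2) show ?thesis by auto
qed

lemma finite_faces: "finite (faces P)"
proof -
  obtain p where p: "\<And>F. F \<in> faces P \<Longrightarrow> p F \<in> cell (p F) \<and> cell (p F) \<subseteq> rel_interior F
      \<and> openin (top_of_set (affine hull F)) (cell (p F))"
    using face_contains_cell by metis
  \<comment> \<open>Restriction to \<open>N\<close> fixes the value elsewhere, which puts the keys
    into a finite extensional function space.\<close>
  define key where "key F = restrict (\<lambda>(a, b). sgn (a \<bullet> p F - b)) N" for F
  have "key F \<in> N \<rightarrow>\<^sub>E {-1, 0, 1}" for F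
    by (auto simp: key_def sgn_if split: if_splits)
  then have "finite (key ` faces P)"
    by (rule finite_subset[OF image_subsetI]) (auto simp: finite_planes intro!: finite_PiE)
  moreover have "inj_on key (faces P)"
  proof (rule inj_onI)
    fix F G assume F: "F \<in> faces P" and G: "G \<in> faces P" and eq: "key F = key G"
    have "sgn (a \<bullet> p F - b) = sgn (a \<bullet> p G - b)" if "(a, b) \<in> N" for a b
      using fun_cong[OF eq, of "(a, b)"] that by (simp add: key_def)
    then have C: "cell (p F) = cell (p G)" by (auto simp: cell_def)
    \<comment> \<open>The common cell is nonempty and relatively open in both planes, so the planes
      agree. It also lies in both relative interiors, so each face absorbs the other.\<close>
    have hull: "affine hull F = affine hull G"
      using p[OF F] p[OF G] C affine_hull_openin[of "affine hull F" "cell (p F)"]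
        affine_hull_openin[of "affine hull G" "cell (p G)"] by auto
    have "rel_interior F \<inter> rel_interior G \<noteq> {}" using p[OF F] p[OF G] C by blast
    moreover have "rel_interior F \<subseteq> frontier P" "rel_interior G \<subseteq> frontier P"
      using face_facts(1)[OF F] face_facts(1)[OF G] rel_interior_subset by blast+
    ultimately have "rel_interior F = rel_interior G"
      using face_absorbs[OF F, of "rel_interior G"] face_absorbs[OF G, of "rel_interior F"]
        openin_rel_interior[of F] openin_rel_interior[of G] hull
        face_facts(3)[OF F] face_facts(3)[OF G] by auto
    then show "F = G" using face_facts(4) F G by metis
  qed
  ultimately show ?thesis using finite_imageD by blast
qed

section \<open>Faces crossed outwards by a direction\<close>

definition leaves :: "real^3 \<Rightarrow> real^3 \<Rightarrow> bool" where
  "leaves v y \<longleftrightarrow> (\<exists>\<delta>>0. \<forall>t. 0 < t \<and> t < \<delta> \<longrightarrow> y + t *\<^sub>R v \<notin> P)"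

text \<open>One witness per face is enough: \<open>exit_faces_disjoint\<close> shows that witnesses
  for \<open>v\<close> and for \<open>- v\<close> never occur on the same face.\<close>

definition exit_faces :: "real^3 \<Rightarrow> (real^3) set set" where
  "exit_faces v = {F \<in> faces P. \<exists>q\<in>rel_interior F. leaves v q}"

text \<open>The height of \<open>z + t *\<^sub>R v\<close> above the plane, measured towards the
  outer side, is \<open>t * (\<sigma> * (a \<bullet> v))\<close>, so its sign is the same for all
  small positive times.\<close>

lemma leaves_iff:
  assumes "z \<in> ball y e" "a \<bullet> z = b" "\<sigma> \<in> {1, -1::real}"
    and out: "\<And>w. w \<in> ball y e \<Longrightarrow> \<sigma> * (a \<bullet> w - b) > 0 \<Longrightarrow> w \<notin> P"
    and ins: "\<And>w. w \<in> ball y e \<Longrightarrow> \<sigma> * (a \<bullet> w - b) < 0 \<Longrightarrow> w \<in> interior P"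
    and "a \<bullet> v \<noteq> 0"
  shows "leaves v z \<longleftrightarrow> \<sigma> * (a \<bullet> v) > 0"
proof -
  obtain \<delta> where \<delta>: "\<delta> > 0" "\<And>t. 0 < t \<Longrightarrow> t < \<delta> \<Longrightarrow> z + t *\<^sub>R v \<in> ball y e"
    using short_step_in_ball[OF assms(1), of v] by auto
  have eq: "\<sigma> * (a \<bullet> (z + t *\<^sub>R v) - b) = t * (\<sigma> * (a \<bullet> v))" for t
    using assms(2) by (simp add: inner_simps)
  show ?thesis
  proof
    assume "\<sigma> * (a \<bullet> v) > 0"
    then have "z + t *\<^sub>R v \<notin> P" if "0 < t" "t < \<delta>" for t
      using out[OF \<delta>(2)[OF that]] that by (simp add: eq)
    with \<delta>(1) show "leaves v z" by (auto simp: leaves_def)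
  next
    assume "leaves v z"
    then obtain \<delta>' where \<delta>': "\<delta>' > 0" "\<And>t. 0 < t \<Longrightarrow> t < \<delta>' \<Longrightarrow> z + t *\<^sub>R v \<notin> P"
      by (auto simp: leaves_def)
    define t where "t = min \<delta> \<delta>' / 2"
    have t: "0 < t" "t < \<delta>" "t < \<delta>'" using \<delta>(1) \<delta>'(1) by (auto simp: t_def)
    have "\<not> \<sigma> * (a \<bullet> v) < 0"
    proof
      assume "\<sigma> * (a \<bullet> v) < 0"
      then have "t * (\<sigma> * (a \<bullet> v)) < 0" using t by (simp add: mult_pos_neg)
      then have "z + t *\<^sub>R v \<in> interior P" using ins[OF \<delta>(2)] t by (simp add: eq)
      with \<delta>'(2) t interior_subset show False by blast
    qed
    moreover have "\<sigma> * (a \<bullet> v) \<noteq> 0" using assms(3,6) by auto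
    ultimately show "\<sigma> * (a \<bullet> v) > 0" by linarith
  qed
qed

text \<open>Along a direction parallel to the plane, a short step from a relative interior point
  would stay in \<open>F\<close> and hence in \<open>P\<close>.\<close>

lemma leaves_transversal:
  assumes F: "F \<in> faces P" and q: "q \<in> rel_interior F" "leaves v q"
    and hull: "affine hull F = {x. a \<bullet> x = b}"
  shows "a \<bullet> v \<noteq> 0"
proof
  assume av: "a \<bullet> v = 0"
  obtain e where e: "e > 0" "ball q e \<inter> affine hull F \<subseteq> F"
    using q by (auto simp: mem_rel_interior_ball)
  obtain \<delta> where \<delta>: "\<delta> > 0" "\<And>t. 0 < t \<Longrightarrow> t < \<delta> \<Longrightarrow> q + t *\<^sub>R v \<in> ball q e"
    using short_step_in_ball[of q q e v] e(1) by auto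
  obtain \<delta>' where \<delta>': "\<delta>' > 0" "\<And>t. 0 < t \<Longrightarrow> t < \<delta>' \<Longrightarrow> q + t *\<^sub>R v \<notin> P"
    using q(2) by (auto simp: leaves_def)
  define t where "t = min \<delta> \<delta>' / 2"
  have t: "0 < t" "t < \<delta>" "t < \<delta>'" using \<delta>(1) \<delta>'(1) by (auto simp: t_def)
  have "q \<in> affine hull F" using q(1) rel_interior_subset[of F] by (simp add: hull_inc subset_iff)
  then have "q + t *\<^sub>R v \<in> affine hull F" using av by (simp add: hull inner_simps)
  then have "q + t *\<^sub>R v \<in> F" using e(2) \<delta>(2) t by blast
  then show False using \<delta>'(2) t face_facts(1)[OF F] frontier_subset by blast
qed

text \<open>The points of a relative interior left along \<open>v\<close> and those left along
  \<open>- v\<close> form two disjoint relatively open sets that cover it; connectedness of the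
  relative interior forbids both being nonempty.\<close>

lemma exit_faces_disjoint: "exit_faces v \<inter> exit_faces (- v) = {}"
proof (rule ccontr)
  assume "exit_faces v \<inter> exit_faces (- v) \<noteq> {}"
  then obtain F q q' where F: "F \<in> faces P" and q: "q \<in> rel_interior F" "leaves v q"
    and q': "q' \<in> rel_interior F" "leaves (- v) q'"
    by (auto simp: exit_faces_def)
  obtain a b where ab: "a \<noteq> 0" "affine hull F = {x. a \<bullet> x = b}"
    using face_plane[OF F] .
  have av: "a \<bullet> v \<noteq> 0" using leaves_transversal[OF F q ab(2)] .
  have on: "a \<bullet> y = b" if "y \<in> rel_interior F" for y
    using that ab(2) rel_interior_subset[of F] hull_subset[of F affine] by blast
  \<comment> \<open>By \<open>frontier_near_face\<close> the boundary is flat near \<open>y\<close>,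
    so a single \<sigma> describes the outer side throughout the ball.\<close>
  have local: "\<exists>\<sigma>\<in>{1,-1::real}. \<exists>e>0. \<forall>z\<in>rel_interior F \<inter> ball y e.
      (leaves v z \<longleftrightarrow> \<sigma> * (a \<bullet> v) > 0) \<and> (leaves (- v) z \<longleftrightarrow> \<sigma> * (a \<bullet> (- v)) > 0)"
    if y: "y \<in> rel_interior F" for y
  proof -
    obtain e where e: "e > 0" "frontier P \<inter> ball y e \<subseteq> rel_interior F"
      using frontier_near_face[OF F y] by blast
    have "y \<in> frontier P" using y face_facts(1)[OF F] rel_interior_subset by blast
    moreover have "frontier P \<inter> ball y e \<subseteq> {x. a \<bullet> x = b}" using e on by blast
    ultimately obtain \<sigma> where \<sigma>: "\<sigma> \<in> {1, -1::real}"
      "\<And>w. w \<in> ball y e \<Longrightarrow> \<sigma> * (a \<bullet> w - b) > 0 \<Longrightarrow> w \<notin> P"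
      "\<And>w. w \<in> ball y e \<Longrightarrow> \<sigma> * (a \<bullet> w - b) < 0 \<Longrightarrow> w \<in> interior P"
      using one_sided[OF _ ab(1) on[OF y] e(1)] by blast
    have "leaves u z \<longleftrightarrow> \<sigma> * (a \<bullet> u) > 0" if "z \<in> rel_interior F \<inter> ball y e" "a \<bullet> u \<noteq> 0" for z u
      using that on by (intro leaves_iff[OF _ _ \<sigma>]) auto
    then show ?thesis using \<sigma>(1) e(1) av by (intro bexI[of _ \<sigma>] exI[of _ e]) auto
  qed
  define A where "A u = {y \<in> rel_interior F. leaves u y}" for u
  have "openin (top_of_set (rel_interior F)) (A u)" if u: "u = v \<or> u = - v" for u
  proof (subst openin_contains_ball, intro conjI ballI)
    fix y assume y: "y \<in> A u"
    then obtain \<sigma> e where e: "e > 0" "\<And>z. z \<in> rel_interior F \<inter> ball y e \<Longrightarrow> leaves u z \<longleftrightarrow> \<sigma> * (a \<bullet> u) > (0::real)"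
      using local[of y] u unfolding A_def by blast
    have "leaves u y" "y \<in> rel_interior F" using y by (auto simp: A_def)
    then have "\<sigma> * (a \<bullet> u) > 0" using e(2)[of y] e(1) by simp
    then have "ball y e \<inter> rel_interior F \<subseteq> A u" using e(2) by (auto simp: A_def)
    with e(1) show "\<exists>e>0. ball y e \<inter> rel_interior F \<subseteq> A u" by blast
  qed (auto simp: A_def)
  then have "openin (top_of_set (rel_interior F)) (A v)" "openin (top_of_set (rel_interior F)) (A (- v))"
    by auto
  moreover have iff: "leaves v y \<longleftrightarrow> \<not> leaves (- v) y" if y: "y \<in> rel_interior F" for y
  proof -
    obtain \<sigma> where \<sigma>: "\<sigma> \<in> {1, -1::real}" "leaves v y \<longleftrightarrow> \<sigma> * (a \<bullet> v) > 0" "leaves (- v) y \<longleftrightarrow> \<sigma> * (a \<bullet> (- v)) > 0"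
      using local[OF y] y by (metis Int_iff centre_in_ball)
    with av show ?thesis by auto
  qed
  moreover have "rel_interior F \<subseteq> A v \<union> A (- v)" using iff by (auto simp: A_def)
  moreover have "A v \<inter> A (- v) = {}" using iff by (auto simp: A_def)
  moreover have "A v \<noteq> {}" "A (- v) \<noteq> {}" using q q' by (auto simp: A_def)
  ultimately show False
    using face_facts(3)[OF F] unfolding connected_openin by blast
qed

section \<open>Local conicity and the sight line to an exit face\<close>

text \<open>Planes met inside the ball pass through \<open>x\<close>. One that contained a point of
  the segment other than \<open>x\<close> would contain \<open>y\<close> as well, so the half-open
  segment misses the boundary.\<close>

lemma segment_to_generic_point:
  assumes r: "\<And>a b y. (a, b) \<in> N \<Longrightarrow> a \<bullet> x \<noteq> b \<Longrightarrow> y \<in> ball x r \<Longrightarrow> a \<bullet> y \<noteq> b"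
    and y: "y \<in> ball x r" "y \<in> interior P" "\<And>a b. (a, b) \<in> N \<Longrightarrow> a \<bullet> y \<noteq> b"
    and t: "0 < t" "t \<le> 1"
  shows "x + t *\<^sub>R (y - x) \<in> interior P"
proof -
  define C where "C = (\<lambda>t. x + t *\<^sub>R (y - x)) ` {0<..1}"
  have inball: "x + s *\<^sub>R (y - x) \<in> ball x r" if "0 < s" "s \<le> 1" for s
  proof -
    have "norm (s *\<^sub>R (y - x)) \<le> norm (y - x)" using that by (simp add: mult_left_le_one_le)
    then show ?thesis using y(1) by (simp add: dist_norm norm_minus_commute)
  qed
  have "connected C"
    unfolding C_def by (intro connected_continuous_image continuous_intros) (auto simp: convex_connected)
  moreover have "C \<inter> frontier P = {}"
  proof (rule ccontr)
    assume "C \<inter> frontier P \<noteq> {}"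
    then obtain s a b where s: "0 < s" "s \<le> 1" and m: "(a, b) \<in> N" "a \<bullet> (x + s *\<^sub>R (y - x)) = b"
      using frontier_planes by (auto simp: C_def) blast
    have "a \<bullet> x = b" using r[OF m(1) _ inball[OF s]] m(2) by blast
    then have "s * (a \<bullet> y - b) = 0" using m(2) by (simp add: inner_simps)
    with s y(3)[OF m(1)] show False by simp
  qed
  moreover have "y \<in> C \<inter> P" using y(2) interior_subset by (force simp: C_def intro!: image_eqI[of _ _ 1])
  ultimately have "C \<subseteq> interior P" by (intro connected_misses_frontier) auto
  with t show ?thesis by (simp add: C_def image_subset_iff)
qed

text \<open>That the point at parameter \<open>t\<close> falls outside \<open>P\<close> is an open
  condition on the far end \<open>z\<close>. Were it satisfied, some generic interior
  \<open>y\<close> near \<open>z\<close> would satisfy it too, against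
  \<open>segment_to_generic_point\<close>.\<close>

lemma segment_to_near_point:
  assumes r: "\<And>a b y. (a, b) \<in> N \<Longrightarrow> a \<bullet> x \<noteq> b \<Longrightarrow> y \<in> ball x r \<Longrightarrow> a \<bullet> y \<noteq> b"
    and "x \<in> P" and z: "z \<in> ball x r" "z \<in> P"
  shows "closed_segment x z \<subseteq> P"
proof
  fix p assume "p \<in> closed_segment x z"
  then obtain t where t: "0 \<le> t" "t \<le> 1" "p = x + t *\<^sub>R (z - x)"
    by (auto simp: in_segment algebra_simps)
  show "p \<in> P"
  proof (rule ccontr)
    assume "p \<notin> P"
    with \<open>x \<in> P\<close> t have t0: "0 < t" by (cases "t = 0") auto
    define S where "S = ball x r \<inter> (\<lambda>y. x + t *\<^sub>R (y - x)) -` (- P)"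
    have "open S"
      unfolding S_def using closed
      by (intro open_Int open_vimage open_ball) (auto intro!: continuous_intros)
    moreover have "S \<inter> P \<noteq> {}" using z t \<open>p \<notin> P\<close> by (auto simp: S_def)
    ultimately have "\<exists>y\<in>S \<inter> interior P. \<forall>(a, b)\<in>N. a \<bullet> y \<noteq> b"
      using finite_planes normal_nonzero by (rule generic_interior_point)
    then obtain y where y: "y \<in> S" "y \<in> interior P" "\<And>a b. (a, b) \<in> N \<Longrightarrow> a \<bullet> y \<noteq> b"
      by blast
    have "x + t *\<^sub>R (y - x) \<in> interior P"
      using y t0 t by (intro segment_to_generic_point[OF r]) (auto simp: S_def)
    with y(1) interior_subset show False by (auto simp: S_def)
  qed
qed

text \<open>The walk follows \<open>w\<close>, but the conclusion concerns \<open>d\<close>: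
  \<open>hits\<close> makes both cross every plane met in the same sense, and \<open>unique\<close>
  makes the first exit point a flat boundary point, hence relatively interior to a face.\<close>

lemma exit_point:
  assumes p: "p \<in> interior P" and s: "s > 0" "p + s *\<^sub>R w \<notin> interior P"
    and hits: "\<And>t a b. 0 \<le> t \<Longrightarrow> t \<le> s \<Longrightarrow> (a, b) \<in> N \<Longrightarrow> a \<bullet> (p + t *\<^sub>R w) = b \<Longrightarrow> (a \<bullet> w) * (a \<bullet> d) > 0"
    and unique: "\<And>t a b a' b'. 0 \<le> t \<Longrightarrow> t \<le> s \<Longrightarrow> (a, b) \<in> N \<Longrightarrow> a \<bullet> (p + t *\<^sub>R w) = b \<Longrightarrow>
       (a', b') \<in> N \<Longrightarrow> a' \<bullet> (p + t *\<^sub>R w) = b' \<Longrightarrow> {x. a' \<bullet> x = b'} = {x. a \<bullet> x = b}"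
  shows "\<exists>F\<in>exit_faces d. \<exists>t. 0 \<le> t \<and> t \<le> s \<and> p + t *\<^sub>R w \<in> rel_interior F
    \<and> closed_segment p (p + t *\<^sub>R w) \<subseteq> P"
proof -
  \<comment> \<open>The times outside the interior. The least one exists by compactness, and it is
    positive because \<open>p\<close> is interior.\<close>
  define Z where "Z = {0..s} \<inter> (\<lambda>t. p + t *\<^sub>R w) -` (- interior P)"
  have "compact Z"
    unfolding Z_def
    by (intro compact_Int_closed closed_vimage) (auto intro!: continuous_intros)
  moreover have "s \<in> Z" using s by (simp add: Z_def)
  then have "Z \<noteq> {}" by blast
  ultimately obtain t where t: "t \<in> Z" "\<And>u. u \<in> Z \<Longrightarrow> t \<le> u"
    using compact_attains_inf by metis
  define q where "q = p + t *\<^sub>R w"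
  have t0: "0 < t" using t(1) p by (cases "t = 0") (auto simp: Z_def)
  have ts: "t \<le> s" using t(1) by (auto simp: Z_def)
  have before: "p + u *\<^sub>R w \<in> interior P" if "0 \<le> u" "u < t" for u
    using t(2)[of u] that ts by (auto simp: Z_def)
  have qP: "q \<in> P"
  proof (rule ccontr)
    assume "q \<notin> P"
    then obtain e where e: "e > 0" "ball q e \<subseteq> - P"
      using closed by (metis ComplI open_Compl openE)
    obtain \<delta> where \<delta>: "\<delta> > 0" "\<And>u. 0 < u \<Longrightarrow> u < \<delta> \<Longrightarrow> q + u *\<^sub>R (- w) \<in> ball q e"
      using short_step_in_ball[of q q e "- w"] e(1) by auto
    define u where "u = min \<delta> t / 2"
    have u: "0 < u" "u < \<delta>" "u < t" using \<delta>(1) t0 by (auto simp: u_def)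
    have "q + u *\<^sub>R (- w) = p + (t - u) *\<^sub>R w" by (simp add: q_def algebra_simps)
    then have "q + u *\<^sub>R (- w) \<in> P" using before[of "t - u"] u interior_subset by auto
    with \<delta>(2) e u show False by blast
  qed
  then have qf: "q \<in> frontier P"
    using t(1) closed by (simp add: frontier_def Z_def q_def)
  then obtain a b where m: "(a, b) \<in> N" "a \<bullet> q = b" using frontier_planes by blast
  have aw: "(a \<bullet> w) * (a \<bullet> d) > 0" using hits[of t a b] m t0 ts by (simp add: q_def)
  have a0: "a \<noteq> 0" using normal_nonzero m by blast
  obtain e where e: "e > 0" "\<forall>a b y. (a, b) \<in> N \<longrightarrow> a \<bullet> q \<noteq> b \<longrightarrow> y \<in> ball q e \<longrightarrow> a \<bullet> y \<noteq> b"
    using ball_avoids_hyperplanes[OF finite_planes, of q] .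
  have fr: "frontier P \<inter> ball q e \<subseteq> {x. a \<bullet> x = b}"
  proof
    fix y assume y: "y \<in> frontier P \<inter> ball q e"
    then obtain a' b' where m': "(a', b') \<in> N" "a' \<bullet> y = b'" using frontier_planes by blast
    then have "a' \<bullet> q = b'" using e(2) y by blast
    then have "{x. a' \<bullet> x = b'} = {x. a \<bullet> x = b}"
      using unique[of t a b a' b'] m m' t0 ts by (simp add: q_def)
    with m' show "y \<in> {x. a \<bullet> x = b}" by blast
  qed
  obtain F where F: "F \<in> faces P" "q \<in> rel_interior F"
    using face_through_flat_point[OF a0 m(2) e(1) local_plane_subset_frontier[OF qf a0 m(2) e(1) fr]] by blast
  obtain \<sigma> where \<sigma>: "\<sigma> \<in> {1, -1::real}"
      "\<And>y. y \<in> ball q e \<Longrightarrow> \<sigma> * (a \<bullet> y - b) > 0 \<Longrightarrow> y \<notin> P"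
      "\<And>y. y \<in> ball q e \<Longrightarrow> \<sigma> * (a \<bullet> y - b) < 0 \<Longrightarrow> y \<in> interior P"
    using one_sided[OF qf a0 m(2) e(1) fr] by blast
  have nz: "a \<bullet> w \<noteq> 0" "a \<bullet> d \<noteq> 0" using aw by auto
  \<comment> \<open>Going back from \<open>q\<close> re-enters the interior stretch of the walk. So
    \<open>w\<close> points to the outer side, and \<open>hits\<close> transfers this to
    \<open>d\<close>.\<close>
  have "\<not> leaves (- w) q"
  proof
    assume "leaves (- w) q"
    then obtain \<delta> where \<delta>: "\<delta> > 0" "\<And>u. 0 < u \<Longrightarrow> u < \<delta> \<Longrightarrow> q + u *\<^sub>R (- w) \<notin> P"
      by (auto simp: leaves_def)
    define u where "u = min \<delta> t / 2"
    have u: "0 < u" "u < \<delta>" "u < t" using \<delta>(1) t0 by (auto simp: u_def)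
    have "q + u *\<^sub>R (- w) = p + (t - u) *\<^sub>R w" by (simp add: q_def algebra_simps)
    then have "q + u *\<^sub>R (- w) \<in> P" using before[of "t - u"] u interior_subset by auto
    with \<delta>(2) u show False by blast
  qed
  moreover have "leaves (- w) q \<longleftrightarrow> \<sigma> * (a \<bullet> (- w)) > 0"
    using e(1) m(2) nz by (intro leaves_iff[OF _ _ \<sigma>]) auto
  ultimately have "\<sigma> * (a \<bullet> w) \<ge> 0" by simp
  then have "\<sigma> * (a \<bullet> d) > 0" using \<sigma>(1) aw by (auto simp: zero_less_mult_iff)
  moreover have "leaves d q \<longleftrightarrow> \<sigma> * (a \<bullet> d) > 0"
    using e(1) m(2) nz by (intro leaves_iff[OF _ _ \<sigma>]) auto
  ultimately have "F \<in> exit_faces d" using F by (auto simp: exit_faces_def)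
  moreover have "closed_segment p q \<subseteq> P"
  proof
    fix y assume "y \<in> closed_segment p q"
    then obtain u where u: "0 \<le> u" "u \<le> 1" "y = p + (u * t) *\<^sub>R w"
      by (auto simp: in_segment q_def algebra_simps)
    show "y \<in> P"
    proof (cases "u = 1")
      case True
      then show ?thesis using u qP by (simp add: q_def)
    next
      case False
      then have "u * t < t" using u t0 by simp
      then show ?thesis using before[of "u * t"] u t0 interior_subset by auto
    qed
  qed
  ultimately show ?thesis using F(2) t0 ts unfolding q_def by (intro bexI[of _ F] exI[of _ t]) auto
qed

text \<open>Let \<open>w = d + \<epsilon> v\<close> be the tilted direction. If \<open>w\<close> points from \<open>x\<close> into the interior, the ray
  along \<open>w\<close> is followed until it leaves \<open>P\<close>. Otherwise the exit face passes through \<open>x\<close>: the path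
  first goes to the interior point \<open>x + \<tau> \<epsilon> v\<close>, then along \<open>d\<close>, and leaves \<open>P\<close> before it reaches
  \<open>x + \<tau> w\<close>, all this within a ball around \<open>x\<close> in which \<open>P\<close> is a cone. The finite set \<open>W\<close> collects the
  vectors that \<open>v\<close> must not be orthogonal to, so that neither path meets two planes at once.\<close>

lemma sees_exit_face:
  assumes "x \<in> P" "d \<noteq> 0"
  shows "\<exists>F\<in>exit_faces d. \<exists>q\<in>rel_interior F. closed_segment x q \<subseteq> P"
proof -
  obtain r where r: "r > 0" "\<forall>a b y. (a, b) \<in> N \<longrightarrow> a \<bullet> x \<noteq> b \<longrightarrow> y \<in> ball x r \<longrightarrow> a \<bullet> y \<noteq> b"
    using ball_avoids_hyperplanes[OF finite_planes, of x] .
  \<comment> \<open>If the ray from \<open>x\<close> along \<open>w\<close> meets two planes at time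
    \<open>u\<close>, then \<open>b - a \<bullet> x = u * (a \<bullet> w)\<close> for both, and
    their \<omega> is orthogonal to \<open>w\<close>. If the walk along \<open>d\<close> from
    \<open>x + (\<tau> * \<epsilon>) *\<^sub>R v\<close> meets two planes through \<open>x\<close>
    at once, their \<omega>' is orthogonal to \<open>v\<close>.\<close>
  define \<omega> where "\<omega> = (\<lambda>((a, b), (a', b')). (b - a \<bullet> x) *\<^sub>R a' - (b' - a' \<bullet> x) *\<^sub>R a)"
  define \<omega>' where "\<omega>' = (\<lambda>((a::real^3, b::real), (a', b'::real)). (a' \<bullet> d) *\<^sub>R a - (a \<bullet> d) *\<^sub>R a')"
  define W where "W = fst ` N \<union> \<omega> ` (N \<times> N) \<union> \<omega>' ` (N \<times> N)"
  have finW: "finite W" using finite_planes by (simp add: W_def)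
  \<comment> \<open>Missing the plane through \<open>x\<close> with normal \<open>w\<close> means
    \<open>w \<bullet> (y - x) \<noteq> 0\<close>, so one generic point \<open>y\<close> meets all
    conditions on \<open>v\<close>.\<close>
  define M where "M = N \<union> (\<lambda>w. (w, w \<bullet> x)) ` {w \<in> W. w \<noteq> 0}"
  have "ball x r \<inter> P \<noteq> {}" using \<open>x \<in> P\<close> r(1) centre_in_ball by blast
  then have "\<exists>y\<in>ball x r \<inter> interior P. \<forall>(a, b)\<in>M. a \<bullet> y \<noteq> b"
    using finite_planes finW normal_nonzero
    by (intro generic_interior_point) (auto simp: M_def)
  then obtain y where y: "y \<in> ball x r" "y \<in> interior P" "\<And>a b. (a, b) \<in> M \<Longrightarrow> a \<bullet> y \<noteq> b"
    by blast
  define v where "v = y - x"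
  have vW: "w \<bullet> v \<noteq> 0" if "w \<in> W" "w \<noteq> 0" for w
  proof -
    have "(w, w \<bullet> x) \<in> M" using that by (auto simp: M_def)
    then show ?thesis using y(3)[of w "w \<bullet> x"] by (simp add: v_def inner_diff_right)
  qed
  have vN: "a \<bullet> v \<noteq> 0" if "(a, b) \<in> N" for a b
    using that normal_nonzero[OF that] by (intro vW) (force simp: W_def)+
  have vint: "x + t *\<^sub>R v \<in> interior P" if "0 < t" "t \<le> 1" for t
    unfolding v_def using r y that by (intro segment_to_generic_point[of x r]) (auto simp: M_def)

  obtain B where B: "B > 0" "\<And>z. z \<in> P \<Longrightarrow> norm (z - x) \<le> B"
  proof -
    have "bounded ((\<lambda>z. z - x) ` P)"
      using compact compact_imp_bounded bounded_minus_comp bounded_translation_minus by blast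
    then show ?thesis using that by (auto simp: bounded_pos)
  qed
  \<comment> \<open>Since \<open>norm w\<close> will be at least \<open>norm d / 2\<close>, the
    point at time \<open>R\<close> is at distance at least \<open>B + norm d\<close> from
    \<open>x\<close>, beyond the reach of \<open>P\<close>.\<close>
  define R where "R = 2 * B / norm d + 2"
  have R2: "R \<ge> 2" using B(1) by (simp add: R_def)
  have "\<forall>\<^sub>F \<epsilon> in at_right 0. \<forall>m\<in>N. fst m \<bullet> d \<noteq> 0 \<longrightarrow> (fst m \<bullet> (d + \<epsilon> *\<^sub>R v)) * (fst m \<bullet> d) > 0"
    using finite_planes eventually_tilted_inner_sign
    by (intro eventually_ball_finite ballI) (auto simp: eventually_mono)
  \<comment> \<open>Towards a plane parallel to \<open>d\<close>, only the tilt makes progress, at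
    rate \<open>\<epsilon> * \<bar>a \<bullet> v\<bar>\<close>; this condition keeps such a plane
    out of reach up to time \<open>R\<close>.\<close>
  moreover have "\<forall>\<^sub>F \<epsilon> in at_right 0. \<forall>m\<in>N. fst m \<bullet> x \<noteq> snd m \<longrightarrow> \<epsilon> * (\<bar>fst m \<bullet> v\<bar> * R) < \<bar>snd m - fst m \<bullet> x\<bar>"
  proof (intro eventually_ball_finite[OF finite_planes] ballI)
    fix m :: "(real^3) \<times> real"
    show "\<forall>\<^sub>F \<epsilon> in at_right 0. fst m \<bullet> x \<noteq> snd m \<longrightarrow> \<epsilon> * (\<bar>fst m \<bullet> v\<bar> * R) < \<bar>snd m - fst m \<bullet> x\<bar>"
      using eventually_scaled_less[of "\<bar>snd m - fst m \<bullet> x\<bar>" "\<bar>fst m \<bullet> v\<bar> * R"]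
      by (cases "fst m \<bullet> x = snd m") auto
  qed
  moreover have "\<forall>\<^sub>F \<epsilon> in at_right 0. \<forall>w\<in>W. w \<noteq> 0 \<longrightarrow> w \<bullet> (d + \<epsilon> *\<^sub>R v) \<noteq> 0"
  proof (intro eventually_ball_finite[OF finW] ballI)
    fix w assume "w \<in> W"
    then show "\<forall>\<^sub>F \<epsilon> in at_right 0. w \<noteq> 0 \<longrightarrow> w \<bullet> (d + \<epsilon> *\<^sub>R v) \<noteq> 0"
      using vW[of w] eventually_tilted_inner_nonzero[of w v d] by (cases "w = 0") auto
  qed
  moreover have "\<forall>\<^sub>F \<epsilon> in at_right (0::real). \<epsilon> * 1 < 1"
    by (rule eventually_scaled_less) simp
  moreover have "\<forall>\<^sub>F \<epsilon> in at_right 0. \<epsilon> * norm v < norm d / 2"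
    using \<open>d \<noteq> 0\<close> by (intro eventually_scaled_less) simp
  moreover have "\<forall>\<^sub>F \<epsilon> in at_right (0::real). 0 < \<epsilon>"
    by (rule eventually_at_right_less)
  ultimately obtain \<epsilon> where \<epsilon>_props: "\<forall>m\<in>N. fst m \<bullet> d \<noteq> 0 \<longrightarrow> (fst m \<bullet> (d + \<epsilon> *\<^sub>R v)) * (fst m \<bullet> d) > 0"
      "\<forall>m\<in>N. fst m \<bullet> x \<noteq> snd m \<longrightarrow> \<epsilon> * (\<bar>fst m \<bullet> v\<bar> * R) < \<bar>snd m - fst m \<bullet> x\<bar>"
      "\<forall>w\<in>W. w \<noteq> 0 \<longrightarrow> w \<bullet> (d + \<epsilon> *\<^sub>R v) \<noteq> 0" "\<epsilon> * 1 < 1" "\<epsilon> * norm v < norm d / 2" "0 < \<epsilon>"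
    by (rule eventually_happens'[OF trivial_limit_at_right_real eventually_conj[OF _ eventually_conj[OF _
          eventually_conj[OF _ eventually_conj[OF _ eventually_conj]]]], THEN exE]) blast+
  then have \<epsilon>: "\<epsilon> > 0" "\<epsilon> < 1" "\<epsilon> * norm v < norm d / 2"
    and sign: "\<And>a b. (a, b) \<in> N \<Longrightarrow> a \<bullet> d \<noteq> 0 \<Longrightarrow> (a \<bullet> (d + \<epsilon> *\<^sub>R v)) * (a \<bullet> d) > 0"
    and far: "\<And>a b. (a, b) \<in> N \<Longrightarrow> a \<bullet> x \<noteq> b \<Longrightarrow> \<epsilon> * (\<bar>a \<bullet> v\<bar> * R) < \<bar>b - a \<bullet> x\<bar>"
    and tilt: "\<And>w. w \<in> W \<Longrightarrow> w \<noteq> 0 \<Longrightarrow> w \<bullet> (d + \<epsilon> *\<^sub>R v) \<noteq> 0"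
    by auto
  define w where "w = d + \<epsilon> *\<^sub>R v"

  \<comment> \<open>The bound keeps the offset, the tilted step and the walk along \<open>d\<close>
    in the ball where \<open>P\<close> is conical.\<close>
  obtain \<tau> where \<tau>: "0 < \<tau>" "\<tau> \<le> 1" "\<tau> * (norm d + norm v) < r"
  proof -
    define \<tau> where "\<tau> = min 1 (r / (norm d + norm v + 1))"
    have pos: "norm d + norm v + 1 > 0" by (simp add: add_nonneg_pos)
    have "0 < \<tau>" "\<tau> \<le> 1" using r(1) pos by (auto simp: \<tau>_def)
    moreover have "\<tau> * (norm d + norm v + 1) \<le> r"
      unfolding pos_le_divide_eq[OF pos, symmetric] by (simp add: \<tau>_def)
    ultimately show ?thesis using that[of \<tau>] by (simp add: algebra_simps)
  qed
  have small: "x + (\<tau> * \<epsilon>) *\<^sub>R v + t *\<^sub>R d \<in> ball x r" if "0 \<le> t" "t \<le> \<tau>" for t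
  proof -
    have "norm ((\<tau> * \<epsilon>) *\<^sub>R v + t *\<^sub>R d) \<le> (\<tau> * \<epsilon>) * norm v + t * norm d"
      using \<tau> \<epsilon> that by (intro norm_triangle_le) simp
    also have "\<dots> \<le> \<tau> * norm v + \<tau> * norm d"
      using \<tau> \<epsilon> that by (intro add_mono mult_right_mono) auto
    also have "\<dots> < r" using \<tau>(3) by (simp add: algebra_simps)
    finally have "norm ((\<tau> * \<epsilon>) *\<^sub>R v + t *\<^sub>R d) < r" .
    moreover have "x - (x + (\<tau> * \<epsilon>) *\<^sub>R v + t *\<^sub>R d) = - ((\<tau> * \<epsilon>) *\<^sub>R v + t *\<^sub>R d)"
      by simp
    ultimately show ?thesis by (simp only: mem_ball dist_norm norm_minus_cancel)
  qed
  have z0: "x + \<tau> *\<^sub>R w = x + (\<tau> * \<epsilon>) *\<^sub>R v + \<tau> *\<^sub>R d"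
    by (simp add: w_def algebra_simps)
  have z0_ball: "x + \<tau> *\<^sub>R w \<in> ball x r"
    unfolding z0 using \<tau>(1) by (intro small) auto
  show ?thesis
  proof (cases "x + \<tau> *\<^sub>R w \<in> interior P")
    case True
    \<comment> \<open>Since the ray starts at \<open>x\<close> and is transversal to the plane, it
      could meet a plane through \<open>x\<close> only at time 0.\<close>
    have hit: "a \<bullet> d \<noteq> 0 \<and> a \<bullet> x \<noteq> b"
      if m: "(a, b) \<in> N" and u: "0 < u" "u \<le> R" and h: "a \<bullet> (x + u *\<^sub>R w) = b" for a b u
    proof -
      have ad: "a \<bullet> d \<noteq> 0"
      proof
        assume ad: "a \<bullet> d = 0"
        have eq: "u * \<epsilon> * (a \<bullet> v) = b - a \<bullet> x" using h ad by (simp add: w_def inner_simps)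
        have "a \<bullet> x \<noteq> b" using eq u \<epsilon> vN[OF m] by (metis diff_self less_irrefl mult_eq_0_iff)
        then have "\<epsilon> * (\<bar>a \<bullet> v\<bar> * R) < \<bar>b - a \<bullet> x\<bar>" using far[OF m] by blast
        also have "\<bar>b - a \<bullet> x\<bar> = \<epsilon> * (\<bar>a \<bullet> v\<bar> * u)"
          using u \<epsilon> by (simp add: eq[symmetric] abs_mult)
        also have "\<dots> \<le> \<epsilon> * (\<bar>a \<bullet> v\<bar> * R)"
          using u \<epsilon> by (intro mult_left_mono) auto
        finally show False by simp
      qed
      then have "a \<bullet> w \<noteq> 0" using sign[OF m] by (auto simp: w_def)
      moreover have "u * (a \<bullet> w) = b - a \<bullet> x" using h by (simp add: inner_simps)
      ultimately show ?thesis using ad u by auto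
    qed
    have shift: "x + \<tau> *\<^sub>R w + t *\<^sub>R w = x + (\<tau> + t) *\<^sub>R w" for t
      by (simp add: algebra_simps)
    have "x + R *\<^sub>R w \<notin> P"
    proof
      assume "x + R *\<^sub>R w \<in> P"
      then have "R * norm w \<le> B" using B(2)[of "x + R *\<^sub>R w"] R2 by simp
      moreover have "norm w \<ge> norm d / 2"
      proof -
        have "norm d \<le> norm w + norm (\<epsilon> *\<^sub>R v)"
          using norm_triangle_ineq4[of w "\<epsilon> *\<^sub>R v"] by (simp add: w_def)
        then show ?thesis using \<epsilon> by simp
      qed
      then have "R * (norm d / 2) \<le> R * norm w" using R2 by (intro mult_left_mono) auto
      moreover have "R * (norm d / 2) = B + norm d" using \<open>d \<noteq> 0\<close> by (simp add: R_def field_simps)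
      moreover have "norm d > 0" using \<open>d \<noteq> 0\<close> by simp
      ultimately show False by linarith
    qed
    then have out: "x + \<tau> *\<^sub>R w + (R - \<tau>) *\<^sub>R w \<notin> interior P"
      using interior_subset by (auto simp: shift)
    \<comment> \<open>The walk starts at time \<tau>, because \<open>exit_point\<close> asks for an
      interior start and \<open>x\<close> may be on the boundary. The initial stretch is supplied by
      conicity.\<close>
    have "\<exists>F\<in>exit_faces d. \<exists>t. 0 \<le> t \<and> t \<le> R - \<tau> \<and> x + \<tau> *\<^sub>R w + t *\<^sub>R w \<in> rel_interior F
        \<and> closed_segment (x + \<tau> *\<^sub>R w) (x + \<tau> *\<^sub>R w + t *\<^sub>R w) \<subseteq> P"
    proof (rule exit_point[OF True _ out])
      show "R - \<tau> > 0" using R2 \<tau> by simp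
    next
      fix t a b assume t: "0 \<le> t" "t \<le> R - \<tau>" and m: "(a, b) \<in> N" "a \<bullet> (x + \<tau> *\<^sub>R w + t *\<^sub>R w) = b"
      have "a \<bullet> d \<noteq> 0" using hit[OF m(1), of "\<tau> + t"] m(2) t \<tau>(1) unfolding shift by auto
      then show "(a \<bullet> w) * (a \<bullet> d) > 0" using sign[OF m(1)] by (simp add: w_def)
    next
      fix t a b a' b'
      assume t: "0 \<le> t" "t \<le> R - \<tau>" and m: "(a, b) \<in> N" "a \<bullet> (x + \<tau> *\<^sub>R w + t *\<^sub>R w) = b"
        and m': "(a', b') \<in> N" "a' \<bullet> (x + \<tau> *\<^sub>R w + t *\<^sub>R w) = b'"
      have u: "0 < \<tau> + t" "\<tau> + t \<le> R" using t \<tau> by auto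
      have ne: "a \<bullet> x \<noteq> b" "a' \<bullet> x \<noteq> b'"
        using hit[OF m(1) u] hit[OF m'(1) u] m(2) m'(2) unfolding shift by auto
      have eq: "b - a \<bullet> x = (\<tau> + t) * (a \<bullet> w)" "b' - a' \<bullet> x = (\<tau> + t) * (a' \<bullet> w)"
        using m(2) m'(2) unfolding shift by (auto simp: inner_add_right)
      have mem: "\<omega> ((a, b), (a', b')) \<in> W" using m m' by (auto simp: W_def)
      have "\<omega> ((a, b), (a', b')) \<bullet> w = 0" by (simp add: \<omega>_def eq inner_diff_left)
      then have "\<omega> ((a, b), (a', b')) = 0" using tilt[OF mem] by (auto simp: w_def)
      then have "(b - a \<bullet> x) *\<^sub>R a' = (b' - a' \<bullet> x) *\<^sub>R a" by (simp add: \<omega>_def)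
      then show "{x. a' \<bullet> x = b'} = {x. a \<bullet> x = b}"
        using ne m(2) m'(2) by (intro proportional_hyperplanes) auto
    qed
    then obtain F t where F: "F \<in> exit_faces d" "x + (\<tau> + t) *\<^sub>R w \<in> rel_interior F" and "0 \<le> t"
      and seg: "closed_segment (x + \<tau> *\<^sub>R w) (x + (\<tau> + t) *\<^sub>R w) \<subseteq> P"
      unfolding shift by blast
    have "x + \<tau> *\<^sub>R w \<in> closed_segment x (x + (\<tau> + t) *\<^sub>R w)"
    proof -
      define u where "u = \<tau> / (\<tau> + t)"
      have "0 \<le> u" "u \<le> 1" and ut: "u * (\<tau> + t) = \<tau>"
        using \<tau>(1) \<open>0 \<le> t\<close> by (auto simp: u_def)
      moreover have "x + \<tau> *\<^sub>R w = (1 - u) *\<^sub>R x + u *\<^sub>R (x + (\<tau> + t) *\<^sub>R w)"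
        by (simp only: scaleR_add_right scaleR_left_diff_distrib scaleR_scaleR ut) simp
      ultimately show ?thesis unfolding in_segment by blast
    qed
    then have "closed_segment x (x + (\<tau> + t) *\<^sub>R w)
        = closed_segment x (x + \<tau> *\<^sub>R w) \<union> closed_segment (x + \<tau> *\<^sub>R w) (x + (\<tau> + t) *\<^sub>R w)"
      using Un_closed_segment by blast
    moreover have "closed_segment x (x + \<tau> *\<^sub>R w) \<subseteq> P"
      using r(2) \<open>x \<in> P\<close> z0_ball True interior_subset by (intro segment_to_near_point[of x r]) auto
    ultimately show ?thesis using F seg by blast
  next
    case False
    have p: "x + (\<tau> * \<epsilon>) *\<^sub>R v \<in> interior P"
      using \<tau> \<epsilon> by (intro vint) (auto intro: mult_le_one)
    \<comment> \<open>The start is off every plane by \<open>vN\<close>, so a plane through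
      \<open>x\<close> is reached only if \<open>d\<close> is transversal to it.\<close>
    have hit: "a \<bullet> x = b \<and> \<tau> * \<epsilon> * (a \<bullet> v) = - (t * (a \<bullet> d)) \<and> a \<bullet> d \<noteq> 0"
      if m: "(a, b) \<in> N" and t: "0 \<le> t" "t \<le> \<tau>" and h: "a \<bullet> (x + (\<tau> * \<epsilon>) *\<^sub>R v + t *\<^sub>R d) = b" for a b t
    proof -
      have "a \<bullet> x = b" using r(2) small[OF t] m h by blast
      then have eq: "\<tau> * \<epsilon> * (a \<bullet> v) = - (t * (a \<bullet> d))" using h by (simp add: inner_add_right)
      have "\<tau> * \<epsilon> * (a \<bullet> v) \<noteq> 0" using \<tau> \<epsilon> vN[OF m] by simp
      with eq \<open>a \<bullet> x = b\<close> show ?thesis by auto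
    qed
    have "\<exists>F\<in>exit_faces d. \<exists>t. 0 \<le> t \<and> t \<le> \<tau> \<and> x + (\<tau> * \<epsilon>) *\<^sub>R v + t *\<^sub>R d \<in> rel_interior F
        \<and> closed_segment (x + (\<tau> * \<epsilon>) *\<^sub>R v) (x + (\<tau> * \<epsilon>) *\<^sub>R v + t *\<^sub>R d) \<subseteq> P"
    proof (rule exit_point[OF p \<tau>(1)])
      show "x + (\<tau> * \<epsilon>) *\<^sub>R v + \<tau> *\<^sub>R d \<notin> interior P" using False z0 by simp
    next
      fix t a b assume "0 \<le> t" "t \<le> \<tau>" "(a, b) \<in> N" "a \<bullet> (x + (\<tau> * \<epsilon>) *\<^sub>R v + t *\<^sub>R d) = b"
      then have "a \<bullet> d \<noteq> 0" using hit by blast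
      then show "(a \<bullet> d) * (a \<bullet> d) > 0" by (auto simp: zero_less_mult_iff linorder_neq_iff)
    next
      fix t a b a' b'
      assume t: "0 \<le> t" "t \<le> \<tau>" and m: "(a, b) \<in> N" "a \<bullet> (x + (\<tau> * \<epsilon>) *\<^sub>R v + t *\<^sub>R d) = b"
        and m': "(a', b') \<in> N" "a' \<bullet> (x + (\<tau> * \<epsilon>) *\<^sub>R v + t *\<^sub>R d) = b'"
      note h = hit[OF m(1) t m(2)] and h' = hit[OF m'(1) t m'(2)]
      have mem: "\<omega>' ((a, b), (a', b')) \<in> W" using m m' by (auto simp: W_def)
      have "(\<tau> * \<epsilon>) * (\<omega>' ((a, b), (a', b')) \<bullet> v)
          = (a' \<bullet> d) * (\<tau> * \<epsilon> * (a \<bullet> v)) - (a \<bullet> d) * (\<tau> * \<epsilon> * (a' \<bullet> v))"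
        by (simp add: \<omega>'_def inner_diff_left algebra_simps)
      also have "\<dots> = 0" using h h' by simp
      finally have "\<omega>' ((a, b), (a', b')) \<bullet> v = 0" using \<tau> \<epsilon> by simp
      then have "\<omega>' ((a, b), (a', b')) = 0" using vW[OF mem] by blast
      then have "(a \<bullet> d) *\<^sub>R a' = (a' \<bullet> d) *\<^sub>R a" by (simp add: \<omega>'_def)
      then show "{x. a' \<bullet> x = b'} = {x. a \<bullet> x = b}"
        using h h' by (intro proportional_hyperplanes) auto
    qed
    then obtain F t where F: "F \<in> exit_faces d" "x + (\<tau> * \<epsilon>) *\<^sub>R v + t *\<^sub>R d \<in> rel_interior F"
      and t: "0 \<le> t" "t \<le> \<tau>" by blast
    \<comment> \<open>The path was bent, but it ended inside the conical ball, so the straight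
      segment from \<open>x\<close> also stays in \<open>P\<close>.\<close>
    have "x + (\<tau> * \<epsilon>) *\<^sub>R v + t *\<^sub>R d \<in> P"
      using F rel_interior_subset face_facts(1) frontier_subset by (fastforce simp: exit_faces_def)
    then have "closed_segment x (x + (\<tau> * \<epsilon>) *\<^sub>R v + t *\<^sub>R d) \<subseteq> P"
      using r(2) \<open>x \<in> P\<close> small[OF t] by (intro segment_to_near_point[of x r]) auto
    with F show ?thesis by blast
  qed
qed

section \<open>Exit faces as guards\<close>

text \<open>Links the prescribed normals to \<open>leaves_transversal\<close>: dimension two forces
  the affine hull of \<open>F\<close> to be the full plane orthogonal to \<open>u\<close>.\<close>

lemma exit_face_transversal:
  assumes F: "F \<in> exit_faces v" and u: "u \<noteq> 0" "\<And>x y. x \<in> F \<Longrightarrow> y \<in> F \<Longrightarrow> (x - y) \<bullet> u = 0"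
  shows "u \<bullet> v \<noteq> 0"
proof -
  obtain q where q: "F \<in> faces P" "q \<in> rel_interior F" "leaves v q"
    using F by (auto simp: exit_faces_def)
  obtain a b where ab: "a \<noteq> 0" "affine hull F = {x. a \<bullet> x = b}"
    using face_plane[OF q(1)] .
  have qF: "q \<in> F" using q(2) rel_interior_subset by blast
  have "F \<subseteq> {x. u \<bullet> x = u \<bullet> q}"
    using u(2)[OF _ qF] by (simp add: subset_iff inner_diff_left inner_commute[of u])
  then have "affine hull F \<subseteq> {x. u \<bullet> x = u \<bullet> q}"
    by (intro hull_minimal affine_hyperplane)
  moreover have "affine hull F \<noteq> {}" using qF by auto
  moreover have "aff_dim (affine hull F) = aff_dim {x. u \<bullet> x = u \<bullet> q}"
    using ab u(1) by simp
  ultimately have "affine hull F = {x. u \<bullet> x = u \<bullet> q}"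
    by (intro affine_dim_equal) (auto simp: affine_hyperplane)
  with leaves_transversal[OF q] show ?thesis by blast
qed

lemma guardsI:
  assumes "\<And>x. x \<in> P \<Longrightarrow> \<exists>q\<in>S. closed_segment x q \<subseteq> P"
  shows "guards P S"
proof -
  have "vis_region P S \<subseteq> P"
    by (auto simp: vis_region_def visible_def)
  moreover have "P \<subseteq> vis_region P S"
    using assms by (force simp: vis_region_def visible_def closed_segment_commute)
  ultimately show ?thesis by (simp add: guards_def)
qed

text \<open>The exit point seen is relatively interior, so the open guards suffice, and the closed
  ones contain them.\<close>

lemma exit_faces_guard:
  assumes "d \<noteq> 0"
  shows "guards P (\<Union>(exit_faces d))" "guards P (\<Union>F\<in>exit_faces d. rel_interior F)"
proof -
  show "guards P (\<Union>F\<in>exit_faces d. rel_interior F)"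
    using sees_exit_face[OF _ assms] by (intro guardsI) blast
  show "guards P (\<Union>(exit_faces d))"
  proof (rule guardsI)
    fix x assume "x \<in> P"
    then obtain F q where "F \<in> exit_faces d" "q \<in> rel_interior F" "closed_segment x q \<subseteq> P"
      using sees_exit_face[OF _ assms] by blast
    then show "\<exists>q\<in>\<Union>(exit_faces d). closed_segment x q \<subseteq> P"
      using rel_interior_subset by blast
  qed
qed

end

section \<open>Planes obtained from the tetrahedra\<close>

lemma tetrahedron_flat_sided:
  assumes "tetrahedron T"
  shows "compact T" "closure (interior T) = T"
    "\<exists>N. finite N \<and> (\<forall>(a, b)\<in>N. a \<noteq> 0) \<and> frontier T \<subseteq> (\<Union>(a, b)\<in>N. {x. a \<bullet> x = b})"
proof -
  obtain V where V: "card V = 4" "\<not> affine_dependent V" "T = convex hull V"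
    using assms by (auto simp: tetrahedron_def)
  have finV: "finite V" using V(1) card.infinite by fastforce
  have int: "interior T \<noteq> {}"
    using interior_convex_hull_eq_empty[of V] V by simp
  show "compact T" using finV V(3) by (simp add: finite_imp_compact_convex_hull)
  then have "closed T" by (rule compact_imp_closed)
  then show "closure (interior T) = T"
    using convex_closure_interior[of T] int V(3) by simp
  have poly: "polytope T" using finV V(3) by (auto simp: polytope_def)
  have "aff_dim T = 3"
    using aff_dim_nonempty_interior[OF int] by simp
  then have "\<exists>a b. a \<noteq> 0 \<and> F \<subseteq> {x. a \<bullet> x = b}" if "F facet_of T" for F
  proof -
    have "aff_dim F = 2" using that \<open>aff_dim T = 3\<close> by (simp add: facet_of_def)
    then obtain a b where "a \<noteq> 0" "affine hull F = {x. a \<bullet> x = b}" by (rule coplanar_aff_dim)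
    then show ?thesis using hull_subset[of F affine] by blast
  qed
  then obtain a b where ab: "\<And>F. F facet_of T \<Longrightarrow> a F \<noteq> 0 \<and> F \<subseteq> {x. a F \<bullet> x = b F}"
    by metis
  define N where "N = (\<lambda>F. (a F, b F)) ` {F. F facet_of T}"
  have "frontier T = \<Union>{F. F facet_of T}"
    using rel_frontier_of_polyhedron[OF polytope_imp_polyhedron[OF poly]]
      rel_frontier_nonempty_interior[OF int] by simp
  then have "frontier T \<subseteq> (\<Union>(a, b)\<in>N. {x. a \<bullet> x = b})"
    using ab by (force simp: N_def)
  moreover have "finite N" using finite_polytope_facets[OF poly] by (simp add: N_def)
  moreover have "\<forall>(a, b)\<in>N. a \<noteq> 0" using ab by (auto simp: N_def)
  ultimately show "\<exists>N. finite N \<and> (\<forall>(a, b)\<in>N. a \<noteq> 0) \<and> frontier T \<subseteq> (\<Union>(a, b)\<in>N. {x. a \<bullet> x = b})"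
    by blast
qed

text \<open>The boundary of a finite union lies in the union of the boundaries, and regularity
  passes from the tetrahedra to the union. Planes of facets buried inside \<open>P\<close> are
  collected as well.\<close>

lemma polyhedron_flat_sided:
  assumes "polyhedron P"
  obtains N where "flat_sided_solid P N"
proof -
  obtain \<T> where \<T>: "finite \<T>" "\<And>T. T \<in> \<T> \<Longrightarrow> tetrahedron T" "P = \<Union>\<T>"
    and man: "two_manifold (frontier P)"
    using assms by (auto simp: polyhedron_def)
  obtain n where n: "\<And>T. T \<in> \<T> \<Longrightarrow> finite (n T) \<and> (\<forall>(a, b)\<in>n T. a \<noteq> 0)
      \<and> frontier T \<subseteq> (\<Union>(a, b)\<in>n T. {x. a \<bullet> x = b})"
    using tetrahedron_flat_sided(3)[OF \<T>(2)] by metis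
  have comp: "compact P" using \<T> tetrahedron_flat_sided(1) by (auto intro: compact_Union)
  have "T \<subseteq> closure (interior P)" if "T \<in> \<T>" for T
    using tetrahedron_flat_sided(2)[OF \<T>(2)[OF that]] that \<T>(3)
    by (metis Union_upper closure_mono interior_mono)
  then have "P \<subseteq> closure (interior P)" using \<T>(3) by blast
  moreover have "closure (interior P) \<subseteq> P"
    using comp by (simp add: closure_minimal compact_imp_closed interior_subset)
  moreover have "frontier P \<subseteq> (\<Union>(a, b)\<in>\<Union>(n ` \<T>). {x. a \<bullet> x = b})"
  proof
    fix x assume "x \<in> frontier P"
    then obtain T where "T \<in> \<T>" "x \<in> frontier T"
      using frontier_Union_subset[OF \<T>(1)] \<T>(3) by blast
    then show "x \<in> (\<Union>(a, b)\<in>\<Union>(n ` \<T>). {x. a \<bullet> x = b})" using n by blast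
  qed
  ultimately have "flat_sided_solid P (\<Union>(n ` \<T>))"
  proof (unfold_locales)
    show "a \<noteq> 0" if "(a, b) \<in> \<Union>(n ` \<T>)" for a b
      using that n by blast
  qed (use comp man n \<T>(1) in auto)
  then show ?thesis by (rule that)
qed

section \<open>Counting\<close>

text \<open>Take the largest fibre and the largest among the others. Averaging over
  \<open>U\<close>, and over \<open>U\<close> without the first value, bounds \<open>card A\<close>
  in two ways.\<close>

lemma two_heaviest_fibres:
  fixes g :: "'a \<Rightarrow> 'b"
  assumes "finite A" "g ` A \<subseteq> U" "card U \<ge> 2"
  shows "\<exists>u\<in>U. \<exists>u'\<in>U. 2 * card A \<le> card U * card {x\<in>A. g x = u \<or> g x = u'}"
proof -
  have finU: "finite U" "U \<noteq> {}" using assms(3) card.infinite by fastforce+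
  define n where "n u = card {x\<in>A. g x = u}" for u
  have heaviest: "\<exists>u\<in>S. \<forall>w\<in>S. n w \<le> n u" if "finite S" "S \<noteq> {}" for S
  proof -
    have "Max (n ` S) \<in> n ` S" using that by (intro Max_in) auto
    then obtain u where "u \<in> S" "n u = Max (n ` S)" by auto
    then show ?thesis using that by (intro bexI[of _ u]) auto
  qed
  obtain u where u: "u \<in> U" "\<And>w. w \<in> U \<Longrightarrow> n w \<le> n u" using heaviest[OF finU] by blast
  have cU: "card (U - {u}) = card U - 1" using u finU by simp
  then have "U - {u} \<noteq> {}" using assms(3) by force
  then obtain u' where u': "u' \<in> U - {u}" "\<And>w. w \<in> U - {u} \<Longrightarrow> n w \<le> n u'"
    using heaviest[of "U - {u}"] finU by auto
  have total: "(\<Sum>w\<in>U. n w) = card A"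
    using sum.group[OF assms(1) finU(1) assms(2), of "\<lambda>_. 1::nat"] by (simp add: n_def)
  have "card A \<le> card U * n u"
    using sum_bounded_above[of U n "n u"] u total by simp
  moreover have "card A \<le> n u + (card U - 1) * n u'"
    using sum_bounded_above[of "U - {u}" n "n u'"] u' u total cU finU
    by (simp add: sum.remove[of U u])
  ultimately have "2 * card A \<le> card U * (n u + n u')"
  proof -
    assume A: "card A \<le> card U * n u" "card A \<le> n u + (card U - 1) * n u'"
    \<comment> \<open>The two bounds are added with weights \<open>k\<close> and
      \<open>k + 2\<close>, which makes the coefficients of \<open>n u\<close> and
      \<open>n u'\<close> both equal to \<open>(k + 1) * (k + 2)\<close>; then \<open>k + 1\<close>
      cancels.\<close>
    obtain k where k: "card U = k + 2" using assms(3) le_Suc_ex by (metis add.commute)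
    have "(k + 1) * (2 * card A) \<le> (k + 1) * ((k + 2) * (n u + n u'))"
    proof -
      have "k * card A \<le> k * ((k + 2) * n u)" using A(1) k by simp
      moreover have "(k + 2) * card A \<le> (k + 2) * (n u + (k + 1) * n u')"
        using A(2) k by (intro mult_left_mono) auto
      ultimately show ?thesis by (simp add: algebra_simps)
    qed
    then show ?thesis using k by (simp del: mult_Suc mult_Suc_right)
  qed
  moreover have "card {x\<in>A. g x = u \<or> g x = u'} = n u + n u'"
  proof -
    have "{x\<in>A. g x = u \<or> g x = u'} = {x\<in>A. g x = u} \<union> {x\<in>A. g x = u'}" by blast
    moreover have "{x\<in>A. g x = u} \<inter> {x\<in>A. g x = u'} = {}" using u' by auto
    ultimately show ?thesis using assms(1) by (simp add: n_def card_Un_disjoint)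
  qed
  ultimately show ?thesis using u(1) u'(1) by (metis DiffD1)
qed

theorem theorem1:
  fixes P :: "point set" and c :: nat
  assumes "c \<ge> 3" and "polyhedron P" and "c_oriented c P"
  shows "(\<exists>G. finite G \<and> G \<subseteq> faces P \<and>
            int (card G) \<le> \<lfloor>real (card (faces P)) / 2 - real (card (faces P)) / real c\<rfloor> \<and>
            guards P (\<Union>G))
       \<and> (\<exists>G. finite G \<and> G \<subseteq> faces P \<and>
            int (card G) \<le> \<lfloor>real (card (faces P)) / 2 - real (card (faces P)) / real c\<rfloor> \<and>
            guards P (\<Union>F\<in>G. rel_interior F))"
proof -
  obtain N where "flat_sided_solid P N" using polyhedron_flat_sided[OF assms(2)] .
  then interpret flat_sided_solid P N .
  obtain U where U: "card U = c" "\<And>u. u \<in> U \<Longrightarrow> norm u = 1"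
    and "\<And>F. F \<in> faces P \<Longrightarrow> \<exists>u\<in>U. \<forall>x\<in>F. \<forall>y\<in>F. (x - y) \<bullet> u = 0"
    using assms(3) unfolding c_oriented_def by blast
  \<comment> \<open>\<open>U\<close> may contain opposite vectors, both normal to the same face; a
    fixed choice \<open>g\<close> makes the fibres a partition of the faces.\<close>
  then obtain g where g: "\<And>F. F \<in> faces P \<Longrightarrow> g F \<in> U \<and> (\<forall>x\<in>F. \<forall>y\<in>F. (x - y) \<bullet> g F = 0)"
    by metis
  define walls where "walls u u' = {F \<in> faces P. g F = u \<or> g F = u'}" for u u'
  obtain u u' where u: "u \<in> U" "u' \<in> U" and many: "2 * card (faces P) \<le> c * card (walls u u')"
    using two_heaviest_fibres[OF finite_faces, of g U] g U(1) assms(1)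
    unfolding walls_def by (auto simp: image_subset_iff)
  have "dim {u, u'} \<le> card {u, u'}" by (intro dim_le_card') auto
  also have "\<dots> < DIM(real^3)" by (simp add: card_insert_if)
  finally obtain d where d: "d \<noteq> 0" "\<And>y. y \<in> span {u, u'} \<Longrightarrow> orthogonal d y"
    using orthogonal_to_subspace_exists[of "{u, u'}"] by metis
  then have ud: "u \<bullet> d = 0" "u' \<bullet> d = 0"
    using d(2)[of u] d(2)[of u'] by (simp_all add: orthogonal_def inner_commute[of d] span_base)
  have avoid: "exit_faces v \<subseteq> faces P - walls u u'" if v: "v = d \<or> v = - d" for v
  proof -
    have "F \<notin> walls u u'" if F: "F \<in> exit_faces v" for F
    proof
      assume W: "F \<in> walls u u'"
      then have "g F \<in> U" using g by (auto simp: walls_def)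
      then have "g F \<noteq> 0" using U(2) by fastforce
      then have "g F \<bullet> v \<noteq> 0" using exit_face_transversal[OF F] g W by (auto simp: walls_def)
      with W ud v show False by (auto simp: walls_def)
    qed
    then show ?thesis by (auto simp: exit_faces_def)
  qed
  have "card (exit_faces d) + card (exit_faces (- d)) = card (exit_faces d \<union> exit_faces (- d))"
    using exit_faces_disjoint[of d] finite_faces
    by (intro card_Un_disjoint[symmetric]) (auto simp: exit_faces_def)
  also have "\<dots> \<le> card (faces P - walls u u')"
    using avoid finite_faces by (intro card_mono) auto
  also have "\<dots> = card (faces P) - card (walls u u')"
    using finite_faces by (intro card_Diff_subset) (auto simp: walls_def)
  finally have sum: "card (exit_faces d) + card (exit_faces (- d)) \<le> card (faces P) - card (walls u u')" .
  have le: "card (walls u u') \<le> card (faces P)"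
    using finite_faces by (intro card_mono) (auto simp: walls_def)
  obtain e where e: "e \<noteq> 0" "2 * card (exit_faces e) \<le> card (faces P) - card (walls u u')"
  proof (cases "card (exit_faces d) \<le> card (exit_faces (- d))")
    case True
    with sum d(1) that[of d] show ?thesis by simp
  next
    case False
    with sum d(1) that[of "- d"] show ?thesis by simp
  qed
  \<comment> \<open>The walls number at least 2f/c, and half of the remaining faces is at most f/2 -
    f/c; the floor is harmless since a cardinality is an integer.\<close>
  have "real (2 * card (faces P)) \<le> real (c * card (walls u u'))" using many by (rule of_nat_mono)
  then have "2 * real (card (faces P)) / real c \<le> real (card (walls u u'))"
    using assms(1) by (simp add: divide_le_eq mult.commute)
  moreover have "2 * real (card (exit_faces e)) \<le> real (card (faces P)) - real (card (walls u u'))"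
    using e(2) le by linarith
  ultimately have "real (card (exit_faces e)) \<le> real (card (faces P)) / 2 - real (card (faces P)) / real c"
    by (simp add: field_simps)
  then have "int (card (exit_faces e)) \<le> \<lfloor>real (card (faces P)) / 2 - real (card (faces P)) / real c\<rfloor>"
    by (simp add: le_floor_iff)
  moreover have "exit_faces e \<subseteq> faces P" by (auto simp: exit_faces_def)
  ultimately show ?thesis
    using exit_faces_guard[OF e(1)] finite_faces finite_subset by blast
qed

end
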